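(* Let $0<\alpha_1<\alpha_2$, $\beta\ge 1$, $T\ge 2\ln 2$, and let the guidance parameter $w>e$ satisfy $$\frac{\ln w}{16\sqrt w}\le \frac{\alpha_1\alpha_2}{\beta}\qquad\text{and}\qquad \frac{\ln w}{\ln\ln w}\ge 1024\Bigl(\frac{\alpha_2}{\min(\alpha_1,1)}\Bigr)^2 .$$ Run the guided probability flow ODE (defined in the context) with parameter $w$ for the mixture $p=\frac12p^{(1)}+\frac12p^{(-1)}$, from the initialization $x(0)\sim\mathcal N(0,1)$. Then with probability at least $1-\exp\bigl(-\frac{w\alpha_1^2}{512\beta^2}\bigr)$ the output sample $x(T)=\tilde x(1)$ lies in the interval $$\Bigl(\alpha_2\Bigl(1-\frac{32}{\sqrt{\ln w}}\Bigr),\ \alpha_2\Bigr).$$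
   Context: Let $0<\alpha_1<\alpha_2$ and $\beta\ge1$. Let $p^{(1)}$ and $p^{(-1)}$ be probability densities on $\mathbb R$ supported on $[\alpha_1,\alpha_2]$ and $[-\alpha_2,-\alpha_1]$ respectively, which are $\beta$-bounded with respect to each other: $\frac1\beta\le \frac{p^{(-1)}(x_1)}{p^{(1)}(x_2)}\le\beta$ for all $x_1\in(-\alpha_2,-\alpha_1)$, $x_2\in(\alpha_1,\alpha_2)$. Let $p=\frac12p^{(1)}+\frac12p^{(-1)}$, and let $(X_0,z)$ be jointly distributed with $z$ uniform on $\{\pm1\}$ and $X_0\mid z\sim p^{(z)}$. Fix $T>0$; for $t\in[0,T]$ put $a_t=e^{t-T}$, $b_t=\sqrt{1-a_t^2}$, and $X_t=a_tX_0+\xi_t$ with $\xi_t\sim\mathcal N(0,b_t^2)$ independent of $(X_0,z)$. Let $p_t$ denote the density of $X_t$ and $p_t(\cdot\mid z=\pm1)$ the conditional density of $X_t$ given $z=\pm1$. For a guidance parameter $w\ge0$, the guided probability flow ODE (guided toward class $z=1$) is $$x'(t)=x(t)+(w+1)\nabla\log p_t(x(t)\mid z=1)-w\nabla\log p_t(x(t)),\qquad t\in[0,T),$$ with $x(0)\sim\mathcal N(0,1)$; the output sample is $x(T)=\lim_{t\to T}x(t)$. Reparametrize time by $s=a_t=e^{t-T}\in[e^{-T},1]$ and write $\tilde x(s)=x(T+\ln s)$, so $\tilde x(1)=x(T)$. *)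

theory Defs
  imports "HOL-Probability.Probability"
begin

definition sched_a :: "real \<Rightarrow> real \<Rightarrow> real" where
  "sched_a T t = exp (t - T)"

definition sched_b :: "real \<Rightarrow> real \<Rightarrow> real" where
  "sched_b T t = sqrt (1 - (sched_a T t)\<^sup>2)"

text \<open>Density of X_t = a_t X_0 + xi_t, xi_t ~ N(0,b_t^2), when X_0 has density q
  (the class-conditional density p_t(x | z) when q = p^(z)).\<close>
definition noised_density :: "(real \<Rightarrow> real) \<Rightarrow> real \<Rightarrow> real \<Rightarrow> real \<Rightarrow> real" where
  "noised_density q T t x =
     (\<integral>y. q y * normal_density (sched_a T t * y) (sched_b T t) x \<partial>lborel)"

definition mixture_noised_density ::
  "(real \<Rightarrow> real) \<Rightarrow> (real \<Rightarrow> real) \<Rightarrow> real \<Rightarrow> real \<Rightarrow> real \<Rightarrow> real" where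
  "mixture_noised_density p1 pm1 T t x =
     (1/2) * noised_density p1 T t x + (1/2) * noised_density pm1 T t x"

definition guided_flow_solution ::
  "(real \<Rightarrow> real) \<Rightarrow> (real \<Rightarrow> real) \<Rightarrow> real \<Rightarrow> real \<Rightarrow> real \<Rightarrow> (real \<Rightarrow> real) \<Rightarrow> bool" where
  "guided_flow_solution p1 pm1 T w x0 x \<longleftrightarrow>
     x 0 = x0 \<and>
     (\<forall>t\<in>{0..<T}.
        (x has_real_derivative
           (x t + (w + 1) * deriv (\<lambda>y. ln (noised_density p1 T t y)) (x t)
                - w * deriv (\<lambda>y. ln (mixture_noised_density p1 pm1 T t y)) (x t)))
        (at t within {0..<T}))"

definition prob_density_on :: "(real \<Rightarrow> real) \<Rightarrow> real \<Rightarrow> real \<Rightarrow> bool" where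
  "prob_density_on q lo hi \<longleftrightarrow>
     q \<in> borel_measurable borel \<and> (\<forall>x. 0 \<le> q x) \<and>
     integrable lborel q \<and> (\<integral>x. q x \<partial>lborel) = 1 \<and>
     (\<forall>x. x \<notin> {lo..hi} \<longrightarrow> q x = 0)"

end

theory Submission
  imports Defs
begin

text \<open>
  In the time variable \<open>s = a_t\<close> the guided flow reads \<open>x' = (m1 + G - s x) / (1 - s\<^sup>2)\<close>, where \<open>m1\<close> is the
  posterior mean of \<open>X_0\<close> given \<open>X_t = x\<close> and \<open>z = 1\<close>, and \<open>G \<ge> 0\<close> is \<open>w\<close> times the difference between \<open>m1\<close>
  and the posterior mean under the mixture. For \<open>G = 0\<close> the flow transports the law of \<open>X_t\<close> given \<open>z = 1\<close>, so
  along the guided flow \<open>F(s) = P(X_t \<le> x(s) | z = 1)\<close> is nondecreasing, with \<open>F' = G\<close> times a density.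

  Hence \<open>F\<close> converges as \<open>s \<rightarrow> 1\<close>, and \<open>x(s)\<close> tends to the quantile \<open>L\<close> of \<open>p1\<close> of level \<open>lim F\<close>. The
  level is positive because \<open>F\<close> is, so \<open>L > \<alpha>1\<close>; it is less than 1 because near \<open>s = 1\<close> the guidance is
  exponentially small in \<open>1 / (1 - s\<^sup>2)\<close> while the hazard rate of \<open>X_t\<close> grows only polynomially, so \<open>L < \<alpha>2\<close>.

  For large \<open>w\<close> the guidance drives every start \<open>x(0) \<ge> - sqrt w \<alpha>1 / (16 \<beta>)\<close> beyond \<open>2 sqrt (ln w)\<close> before
  \<open>s = 1/2\<close>, where \<open>1 - F \<le> 1 / w\<close>. As \<open>p1\<close> is at least \<open>1 / (\<beta> (\<alpha>2 - \<alpha>1))\<close> on its support, this forces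
  \<open>\<alpha>2 - L \<le> \<beta> \<alpha>2 / w\<close>. The second hypothesis on \<open>w\<close> leaves only one other range, \<open>w\<close> close to \<open>e\<close>, where the
  claimed lower bound is negative.

  The flow preserves the order of initial values, so the good set of initial values is an interval and hence Borel.
\<close>

subsection \<open>Exponential tilts of compactly supported densities\<close>

lemma prob_density_onD:
  assumes "prob_density_on q lo hi"
  shows "q \<in> borel_measurable borel" "\<And>x. 0 \<le> q x" "integrable lborel q"
    "(\<integral>x. q x \<partial>lborel) = 1" "\<And>x. x \<notin> {lo..hi} \<Longrightarrow> q x = 0"
  using assms unfolding prob_density_on_def by auto

text \<open>Polynomial and Gaussian weights need a bound only on the support, so the dominating
  function is a multiple of \<open>q\<close>.\<close>

lemma prob_density_on_integrable_mult:
  assumes q: "prob_density_on q lo hi" and g: "g \<in> borel_measurable borel"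
    and b: "\<And>y. y \<in> {lo..hi} \<Longrightarrow> \<bar>g y\<bar> \<le> C"
  shows "integrable lborel (\<lambda>y. q y * g y)"
proof (rule Bochner_Integration.integrable_bound)
  show "integrable lborel (\<lambda>y. C * q y)"
    using prob_density_onD(3)[OF q] by simp
  show "(\<lambda>y. q y * g y) \<in> borel_measurable lborel"
    using prob_density_onD(1)[OF q] g by simp
  show "AE y in lborel. norm (q y * g y) \<le> norm (C * q y)"
  proof (rule AE_I2)
    fix y
    show "norm (q y * g y) \<le> norm (C * q y)"
    proof (cases "y \<in> {lo..hi}")
      case True
      have "\<bar>g y\<bar> * q y \<le> \<bar>C\<bar> * q y"
        using b[OF True] prob_density_onD(2)[OF q] by (intro mult_right_mono) auto
      then show ?thesis
        using prob_density_onD(2)[OF q, of y] by (auto simp: abs_mult mult.commute)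
    next
      case False
      then show ?thesis using prob_density_onD(5)[OF q] by simp
    qed
  qed
qed

lemma prob_density_on_integral_mono:
  assumes q: "prob_density_on q lo hi"
    and f: "integrable lborel (\<lambda>y. q y * f y)" and g: "integrable lborel (\<lambda>y. q y * g y)"
    and le: "\<And>y. y \<in> {lo..hi} \<Longrightarrow> f y \<le> g y"
  shows "(\<integral>y. q y * f y \<partial>lborel) \<le> (\<integral>y. q y * g y \<partial>lborel)"
proof (rule integral_mono[OF f g])
  fix y
  show "q y * f y \<le> q y * g y"
    by (cases "y \<in> {lo..hi}")
       (use le prob_density_onD[OF q] in \<open>auto intro: mult_left_mono\<close>)
qed

text \<open>If the integral were zero, the nonnegative integrand would vanish almost everywhere, and
  so would \<open>q\<close>, against its total mass 1.\<close>

lemma prob_density_on_integral_pos: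
  assumes q: "prob_density_on q lo hi" and i: "integrable lborel (\<lambda>y. q y * f y)" and f: "\<And>y. 0 < f y"
  shows "0 < (\<integral>y. q y * f y \<partial>lborel)"
proof -
  have n: "AE y in lborel. 0 \<le> q y * f y"
    using prob_density_onD(2)[OF q] f by (intro AE_I2 mult_nonneg_nonneg) (auto simp: less_imp_le)
  have "(\<integral>y. q y * f y \<partial>lborel) \<noteq> 0"
  proof
    assume "(\<integral>y. q y * f y \<partial>lborel) = 0"
    then have "AE y in lborel. q y * f y = 0"
      using integral_nonneg_eq_0_iff_AE[OF i n] by simp
    then have "AE y in lborel. q y = 0"
      by eventually_elim (use f in \<open>auto simp: less_le\<close>)
    then have "(\<integral>y. q y \<partial>lborel) = 0" by (rule integral_eq_zero_AE)
    then show False using prob_density_onD(4)[OF q] by simp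
  qed
  moreover have "0 \<le> (\<integral>y. q y * f y \<partial>lborel)" by (rule integral_nonneg_AE[OF n])
  ultimately show ?thesis by simp
qed

text \<open>Differentiation under the integral sign: by the mean value inequality on the convex set
  \<open>S\<close> the difference quotients are bounded by \<open>C\<close> on the support, so
  dominated convergence applies along sequences. Derivatives within \<open>S\<close> admit the
  one-sided case at the initial time.\<close>

lemma prob_density_on_has_derivative_integral:
  fixes k k' :: "real \<Rightarrow> real \<Rightarrow> real"
  assumes q: "prob_density_on q lo hi" and S: "convex S" "\<theta>0 \<in> S"
    and meas: "\<And>\<theta>. \<theta> \<in> S \<Longrightarrow> k \<theta> \<in> borel_measurable borel" "k' \<theta>0 \<in> borel_measurable borel"
    and int: "\<And>\<theta>. \<theta> \<in> S \<Longrightarrow> integrable lborel (\<lambda>y. q y * k \<theta> y)"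
    and der: "\<And>\<theta> y. \<theta> \<in> S \<Longrightarrow> y \<in> {lo..hi} \<Longrightarrow>
        ((\<lambda>\<theta>. k \<theta> y) has_real_derivative k' \<theta> y) (at \<theta> within S)"
    and bnd: "\<And>\<theta> y. \<theta> \<in> S \<Longrightarrow> y \<in> {lo..hi} \<Longrightarrow> \<bar>k' \<theta> y\<bar> \<le> C"
  shows "((\<lambda>\<theta>. \<integral>y. q y * k \<theta> y \<partial>lborel) has_real_derivative (\<integral>y. q y * k' \<theta>0 y \<partial>lborel))
     (at \<theta>0 within S)"
  unfolding has_field_derivative_iff tendsto_at_iff_sequentially
proof (intro allI impI)
  fix X :: "nat \<Rightarrow> real" assume X: "\<forall>i. X i \<in> S - {\<theta>0}" "X \<longlonglongrightarrow> \<theta>0"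
  have XS: "X i \<in> S" and Xne: "X i - \<theta>0 \<noteq> 0" for i using X(1) by auto
  let ?d = "\<lambda>i y. q y * ((k (X i) y - k \<theta>0 y) / (X i - \<theta>0))"
  note [measurable] = prob_density_onD(1)[OF q] meas(1)[OF XS] meas(1)[OF S(2)] meas(2)
  have lim: "(\<lambda>i. \<integral>y. ?d i y \<partial>lborel) \<longlonglongrightarrow> (\<integral>y. q y * k' \<theta>0 y \<partial>lborel)"
  proof (rule integral_dominated_convergence[where w = "\<lambda>y. C * q y"])
    show "integrable lborel (\<lambda>y. C * q y)" using prob_density_onD(3)[OF q] by simp
    show "AE y in lborel. (\<lambda>i. ?d i y) \<longlonglongrightarrow> q y * k' \<theta>0 y"
    proof (rule AE_I2)
      fix y
      show "(\<lambda>i. ?d i y) \<longlonglongrightarrow> q y * k' \<theta>0 y"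
      proof (cases "y \<in> {lo..hi}")
        case True
        have "((\<lambda>\<theta>. (k \<theta> y - k \<theta>0 y) / (\<theta> - \<theta>0)) \<longlongrightarrow> k' \<theta>0 y) (at \<theta>0 within S)"
          using der[OF S(2) True] unfolding has_field_derivative_iff .
        then have "(\<lambda>i. (k (X i) y - k \<theta>0 y) / (X i - \<theta>0)) \<longlonglongrightarrow> k' \<theta>0 y"
          unfolding tendsto_at_iff_sequentially using X by (auto simp: o_def)
        then show ?thesis by (intro tendsto_intros)
      next
        case False
        then show ?thesis using prob_density_onD(5)[OF q] by simp
      qed
    qed
    show "AE y in lborel. norm (?d i y) \<le> C * q y" for i
    proof (rule AE_I2)
      fix y
      show "norm (?d i y) \<le> C * q y"
      proof (cases "y \<in> {lo..hi}")
        case True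
        have "norm (k (X i) y - k \<theta>0 y) \<le> C * norm (X i - \<theta>0)"
          by (rule field_differentiable_bound[OF S(1), of "\<lambda>\<theta>. k \<theta> y" "\<lambda>\<theta>. k' \<theta> y"])
             (use der bnd True XS S in auto)
        then have "\<bar>(k (X i) y - k \<theta>0 y) / (X i - \<theta>0)\<bar> \<le> C"
          using Xne[of i] by (simp add: abs_divide pos_divide_le_eq)
        then have "q y * \<bar>(k (X i) y - k \<theta>0 y) / (X i - \<theta>0)\<bar> \<le> q y * C"
          using prob_density_onD(2)[OF q, of y] by (intro mult_left_mono)
        then show ?thesis using prob_density_onD(2)[OF q, of y]
          by (auto simp: abs_mult mult.commute)
      next
        case False
        then show ?thesis using prob_density_onD(5)[OF q] by simp
      qed
    qed
  qed (measurable)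
  have eq: "(\<integral>y. ?d i y \<partial>lborel)
      = ((\<integral>y. q y * k (X i) y \<partial>lborel) - (\<integral>y. q y * k \<theta>0 y \<partial>lborel)) / (X i - \<theta>0)" for i
  proof -
    have "?d i = (\<lambda>y. (q y * k (X i) y - q y * k \<theta>0 y) / (X i - \<theta>0))"
      by (auto simp: fun_eq_iff algebra_simps diff_divide_distrib)
    then show ?thesis
      using int[OF XS[of i]] int[OF S(2)] by simp
  qed
  show "((\<lambda>\<theta>. ((\<integral>y. q y * k \<theta> y \<partial>lborel) - (\<integral>y. q y * k \<theta>0 y \<partial>lborel)) / (\<theta> - \<theta>0)) \<circ> X)
       \<longlonglongrightarrow> (\<integral>y. q y * k' \<theta>0 y \<partial>lborel)"
    using lim unfolding eq o_def .
qed

text \<open>Unnormalized moments of the posterior of X_0 given X_t = x, for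
  \<open>l = s * x / (1 - s\<^sup>2)\<close> and
  \<open>c = s\<^sup>2 / (2 * (1 - s\<^sup>2))\<close>. Keeping the two parameters free makes
  differentiation in \<open>l\<close> simply raise \<open>j\<close>.\<close>

definition tilt :: "(real \<Rightarrow> real) \<Rightarrow> nat \<Rightarrow> real \<Rightarrow> real \<Rightarrow> real" where
  "tilt q j l c = (\<integral>y. q y * (y ^ j * exp (l * y - c * y\<^sup>2)) \<partial>lborel)"

text \<open>Also the logarithmic derivative of \<open>tilt q 0 l c\<close> in \<open>l\<close>,
  which is how it enters the score.\<close>

definition tilt_mean :: "(real \<Rightarrow> real) \<Rightarrow> real \<Rightarrow> real \<Rightarrow> real" where
  "tilt_mean q l c = tilt q 1 l c / tilt q 0 l c"

text \<open>A single constant covers all parameters of size at most \<open>B\<close>, as dominated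
  convergence and differentiation under the integral require.\<close>

lemma tilt_kernel_bound:
  fixes y lo hi l c B :: real
  assumes "y \<in> {lo..hi}" "\<bar>l\<bar> \<le> B" "\<bar>c\<bar> \<le> B"
  defines "R \<equiv> max \<bar>lo\<bar> \<bar>hi\<bar>"
  shows "\<bar>y ^ j * exp (l * y - c * y\<^sup>2)\<bar> \<le> R ^ j * exp (B * R + B * R\<^sup>2)"
proof -
  have yR: "\<bar>y\<bar> \<le> R"
    using assms(1) abs_ge_self[of hi] abs_ge_minus_self[of lo] unfolding R_def atLeastAtMost_iff abs_le_iff le_max_iff_disj
    by linarith
  then have y2: "y\<^sup>2 \<le> R\<^sup>2" by (metis abs_le_square_iff abs_of_nonneg abs_ge_zero order.trans)
  have 1: "\<bar>l * y\<bar> \<le> B * R" unfolding abs_mult using assms(2) yR by (intro mult_mono) auto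
  have 2: "\<bar>c * y\<^sup>2\<bar> \<le> B * R\<^sup>2" unfolding abs_mult using assms(3) y2 by (intro mult_mono) auto
  have "exp (l * y - c * y\<^sup>2) \<le> exp (B * R + B * R\<^sup>2)" using 1 2 by auto
  then show "\<bar>y ^ j * exp (l * y - c * y\<^sup>2)\<bar> \<le> R ^ j * exp (B * R + B * R\<^sup>2)"
    unfolding abs_mult power_abs using yR by (intro mult_mono power_mono) auto
qed

lemma tilt_integrable:
  assumes "prob_density_on q lo hi"
  shows "integrable lborel (\<lambda>y. q y * (y ^ j * exp (l * y - c * y\<^sup>2)))"
  by (rule prob_density_on_integrable_mult[OF assms])
     (auto intro: tilt_kernel_bound[where B = "max \<bar>l\<bar> \<bar>c\<bar>"])

lemma tilt_pos:
  assumes q: "prob_density_on q lo hi"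
  shows "0 < tilt q 0 l c"
  unfolding tilt_def
  by (rule prob_density_on_integral_pos[OF q tilt_integrable[OF q]]) simp

lemma tilt_has_derivative:
  assumes q: "prob_density_on q lo hi"
  shows "((\<lambda>l. tilt q j l c) has_real_derivative tilt q (Suc j) l0 c) (at l0)"
proof -
  \<comment> \<open>A bounded neighbourhood of \<open>l0\<close> makes the kernel bound uniform, and
    a derivative is a local notion.\<close>
  let ?S = "{l0 - 1<..<l0 + 1}" and ?B = "max (\<bar>l0\<bar> + 1) \<bar>c\<bar>"
  have "((\<lambda>l. tilt q j l c) has_real_derivative tilt q (Suc j) l0 c) (at l0 within ?S)"
    unfolding tilt_def
  proof (rule prob_density_on_has_derivative_integral[OF q,
      where k' = "\<lambda>l y. y ^ Suc j * exp (l * y - c * y\<^sup>2)"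
        and C = "(max \<bar>lo\<bar> \<bar>hi\<bar>) ^ Suc j * exp (?B * max \<bar>lo\<bar> \<bar>hi\<bar> + ?B * (max \<bar>lo\<bar> \<bar>hi\<bar>)\<^sup>2)"])
    fix l y assume l: "l \<in> ?S" and y: "y \<in> {lo..hi}"
    have "\<bar>l\<bar> \<le> ?B" "\<bar>c\<bar> \<le> ?B" using l by auto
    from tilt_kernel_bound[OF y this]
    show "\<bar>y ^ Suc j * exp (l * y - c * y\<^sup>2)\<bar> \<le> (max \<bar>lo\<bar> \<bar>hi\<bar>) ^ Suc j * exp (?B * max \<bar>lo\<bar> \<bar>hi\<bar> + ?B * (max \<bar>lo\<bar> \<bar>hi\<bar>)\<^sup>2)" .
    show "((\<lambda>l. y ^ j * exp (l * y - c * y\<^sup>2)) has_real_derivative y ^ Suc j * exp (l * y - c * y\<^sup>2))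
       (at l within ?S)"
      by (auto intro!: derivative_eq_intros)
  qed (use tilt_integrable[OF q] in auto)
  then show ?thesis using at_within_open[of l0 ?S] by simp
qed

text \<open>A convergent sequence of parameters is bounded, so the kernel bound supplies a
  dominating multiple of \<open>q\<close>.\<close>

lemma continuous_on_tilt:
  assumes q: "prob_density_on q lo hi"
  shows "continuous_on UNIV (\<lambda>p. tilt q j (fst p) (snd p))"
  unfolding continuous_on_sequentially
proof (intro allI ballI impI, elim conjE)
  fix X :: "nat \<Rightarrow> real \<times> real" and p assume X: "X \<longlonglongrightarrow> p"
  obtain B where B: "\<And>n. norm (X n) \<le> B"
    using convergent_imp_Bseq[OF convergentI[OF X]] unfolding Bseq_def by auto
  have B1: "\<bar>fst (X n)\<bar> \<le> B" "\<bar>snd (X n)\<bar> \<le> B" for n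
    using norm_fst_le[of "fst (X n)" "snd (X n)"] norm_snd_le[of "snd (X n)" "fst (X n)"] B[of n] by auto
  let ?R = "max \<bar>lo\<bar> \<bar>hi\<bar>"
  let ?C = "?R ^ j * exp (B * ?R + B * ?R\<^sup>2)"
  note [measurable] = prob_density_onD(1)[OF q]
  show "((\<lambda>p. tilt q j (fst p) (snd p)) \<circ> X) \<longlonglongrightarrow> tilt q j (fst p) (snd p)"
    unfolding o_def tilt_def
  proof (rule integral_dominated_convergence[where w = "\<lambda>y. ?C * q y"])
    show "integrable lborel (\<lambda>y. ?C * q y)" using prob_density_onD(3)[OF q] by simp
    show "AE y in lborel. (\<lambda>n. q y * (y ^ j * exp (fst (X n) * y - snd (X n) * y\<^sup>2)))
        \<longlonglongrightarrow> q y * (y ^ j * exp (fst p * y - snd p * y\<^sup>2))"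
      by (intro AE_I2 tendsto_intros X)
    show "AE y in lborel. norm (q y * (y ^ j * exp (fst (X n) * y - snd (X n) * y\<^sup>2))) \<le> ?C * q y" for n
    proof (rule AE_I2)
      fix y
      show "norm (q y * (y ^ j * exp (fst (X n) * y - snd (X n) * y\<^sup>2))) \<le> ?C * q y"
      proof (cases "y \<in> {lo..hi}")
        case True
        from tilt_kernel_bound[OF True B1(1) B1(2), of j n n] prob_density_onD(2)[OF q, of y]
        have "q y * \<bar>y ^ j * exp (fst (X n) * y - snd (X n) * y\<^sup>2)\<bar> \<le> q y * ?C"
          by (intro mult_left_mono) auto
        then show ?thesis using prob_density_onD(2)[OF q, of y]
          by (simp add: abs_mult mult.commute)
      qed (use prob_density_onD(5)[OF q] in simp)
    qed
  qed measurable
qed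

lemma tilt_mean_bounds:
  assumes q: "prob_density_on q lo hi"
  shows "lo \<le> tilt_mean q l c" "tilt_mean q l c \<le> hi"
proof -
  have *: "integrable lborel (\<lambda>y. q y * (d * exp (l * y - c * y\<^sup>2)))" for d
    using tilt_integrable[OF q, of 0 l c, THEN integrable_mult_right, of d] by (simp add: ac_simps)
  have e: "(\<integral>y. q y * (d * exp (l * y - c * y\<^sup>2)) \<partial>lborel) = d * tilt q 0 l c" for d
    unfolding tilt_def by (subst integral_mult_right_zero[symmetric]) (simp add: ac_simps)
  have "lo * tilt q 0 l c \<le> tilt q 1 l c"
    unfolding e[symmetric] unfolding tilt_def
    by (rule prob_density_on_integral_mono[OF q * tilt_integrable[OF q]]) auto
  then show "lo \<le> tilt_mean q l c"
    unfolding tilt_mean_def using tilt_pos[OF q] by (simp add: pos_le_divide_eq)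
  have "tilt q 1 l c \<le> hi * tilt q 0 l c"
    unfolding e[symmetric] unfolding tilt_def
    by (rule prob_density_on_integral_mono[OF q tilt_integrable[OF q] *]) auto
  then show "tilt_mean q l c \<le> hi"
    unfolding tilt_mean_def using tilt_pos[OF q] by (simp add: pos_divide_le_eq)
qed

lemma tilt2_le:
  assumes q: "prob_density_on q lo hi"
  shows "tilt q 2 l c \<le> (max \<bar>lo\<bar> \<bar>hi\<bar>)\<^sup>2 * tilt q 0 l c"
proof -
  let ?d = "(max \<bar>lo\<bar> \<bar>hi\<bar>)\<^sup>2"
  have *: "integrable lborel (\<lambda>y. q y * (?d * exp (l * y - c * y\<^sup>2)))"
    using tilt_integrable[OF q, of 0 l c, THEN integrable_mult_right, of ?d] by (simp add: ac_simps)
  have e: "(\<integral>y. q y * (?d * exp (l * y - c * y\<^sup>2)) \<partial>lborel) = ?d * tilt q 0 l c"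
    unfolding tilt_def by (subst integral_mult_right_zero[symmetric]) (simp add: ac_simps)
  show ?thesis
    unfolding e[symmetric] unfolding tilt_def
  proof (rule prob_density_on_integral_mono[OF q tilt_integrable[OF q] *])
    fix y assume "y \<in> {lo..hi}"
    then have "y\<^sup>2 \<le> ?d" by (intro abs_le_square_iff[THEN iffD1]) auto
    then show "y\<^sup>2 * exp (l * y - c * y\<^sup>2) \<le> ?d * exp (l * y - c * y\<^sup>2)" by simp
  qed
qed

lemma tilt2_nonneg:
  assumes q: "prob_density_on q lo hi"
  shows "0 \<le> tilt q 2 l c"
  unfolding tilt_def using prob_density_onD(2)[OF q] by (intro Bochner_Integration.integral_nonneg) auto

text \<open>The derivative of the tilted mean is the tilted variance.\<close>
lemma tilt_mean_lipschitz:
  assumes q: "prob_density_on q lo hi"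
  shows "\<bar>tilt_mean q l c - tilt_mean q l' c\<bar> \<le> 2 * (max \<bar>lo\<bar> \<bar>hi\<bar>)\<^sup>2 * \<bar>l - l'\<bar>"
proof -
  let ?R = "max \<bar>lo\<bar> \<bar>hi\<bar>"
  have "norm (tilt_mean q l c - tilt_mean q l' c) \<le> 2 * ?R\<^sup>2 * norm (l - l')"
  proof (rule field_differentiable_bound[of UNIV "\<lambda>l. tilt_mean q l c"
        "\<lambda>l. tilt q 2 l c / tilt q 0 l c - (tilt_mean q l c)\<^sup>2"])
    fix l
    note pos = tilt_pos[OF q, of l c]
    have D: "((\<lambda>l. tilt q 1 l c / tilt q 0 l c) has_real_derivative
       (tilt q 2 l c * tilt q 0 l c - tilt q 1 l c * tilt q 1 l c) / (tilt q 0 l c * tilt q 0 l c)) (at l)"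
      using DERIV_divide[OF tilt_has_derivative[OF q, of 1 c l] tilt_has_derivative[OF q, of 0 c l]] pos
      by (simp add: numeral_2_eq_2)
    have e: "(tilt q 2 l c * tilt q 0 l c - tilt q 1 l c * tilt q 1 l c) / (tilt q 0 l c * tilt q 0 l c)
      = tilt q 2 l c / tilt q 0 l c - (tilt_mean q l c)\<^sup>2"
      using pos by (simp add: tilt_mean_def field_simps power2_eq_square)
    show "((\<lambda>l. tilt_mean q l c) has_field_derivative tilt q 2 l c / tilt q 0 l c - (tilt_mean q l c)\<^sup>2) (at l within UNIV)"
      using D[unfolded e] by (simp add: tilt_mean_def[abs_def])
    \<comment> \<open>The variance is a difference of two terms, each between 0 and the square of
      \<open>?R\<close>.\<close>
    have "\<bar>tilt_mean q l c\<bar> \<le> ?R" using tilt_mean_bounds[OF q, of l c] by auto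
    then have 1: "(tilt_mean q l c)\<^sup>2 \<le> ?R\<^sup>2" by (intro abs_le_square_iff[THEN iffD1]) auto
    have 2: "tilt q 2 l c / tilt q 0 l c \<le> ?R\<^sup>2"
      using tilt2_le[OF q, of l c] pos by (simp add: pos_divide_le_eq)
    have 3: "0 \<le> tilt q 2 l c / tilt q 0 l c" using tilt2_nonneg[OF q, of l c] pos by simp
    show "norm (tilt q 2 l c / tilt q 0 l c - (tilt_mean q l c)\<^sup>2) \<le> 2 * ?R\<^sup>2"
      unfolding real_norm_def using 1 2 3 zero_le_power2[of "tilt_mean q l c"] by linarith
  qed auto
  then show ?thesis by simp
qed

lemma continuous_on_tilt_mean:
  assumes q: "prob_density_on q lo hi"
  shows "continuous_on UNIV (\<lambda>p. tilt_mean q (fst p) (snd p))"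
  unfolding tilt_mean_def
  using continuous_on_tilt[OF q] tilt_pos[OF q] by (intro continuous_intros) (auto simp: less_le)

subsection \<open>Scalar ordinary differential equations\<close>

text \<open>If \<open>u\<close> exceeded \<open>v\<close> at \<open>s\<close>, the two would meet at
  some earlier \<open>r\<close>, and a Gronwall estimate started at \<open>r\<close> would force
  equality at \<open>s\<close>. The Lipschitz constant may depend on \<open>c\<close>, because the
  guided field is singular at the right end.\<close>

lemma ode_order_preserving:
  fixes f :: "real \<Rightarrow> real \<Rightarrow> real"
  assumes lip: "\<And>c. a \<le> c \<Longrightarrow> c < b \<Longrightarrow> \<exists>K. \<forall>s\<in>{a..c}. \<forall>x y. \<bar>f s x - f s y\<bar> \<le> K * \<bar>x - y\<bar>"
    and u: "\<And>s. s \<in> {a..<b} \<Longrightarrow> (u has_real_derivative f s (u s)) (at s within {a..<b})"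
    and v: "\<And>s. s \<in> {a..<b} \<Longrightarrow> (v has_real_derivative f s (v s)) (at s within {a..<b})"
    and le: "u a \<le> v a" and s: "s \<in> {a..<b}"
  shows "u s \<le> v s"
proof (rule ccontr)
  assume neg: "\<not> u s \<le> v s"
  define h where "h = (\<lambda>t. u t - v t)"
  have D: "(h has_real_derivative f t (u t) - f t (v t)) (at t within {a..<b})" if "t \<in> {a..<b}" for t
    unfolding h_def using u[OF that] v[OF that] by (rule DERIV_diff)
  have ch: "continuous_on {a..s} h"
  proof (rule continuous_on_subset[of "{a..<b}"])
    show "continuous_on {a..<b} h" by (rule DERIV_continuous_on[OF D])
  qed (use s in auto)
  have "\<exists>r\<ge>a. r \<le> s \<and> h r = 0"
    by (rule IVT') (use ch le neg s in \<open>auto simp: h_def\<close>)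
  then obtain r where r: "a \<le> r" "r \<le> s" "h r = 0" by blast
  obtain K where K: "\<And>t x y. t \<in> {a..s} \<Longrightarrow> \<bar>f t x - f t y\<bar> \<le> K * \<bar>x - y\<bar>"
    using lip[of s] s by (auto simp del: atLeastAtMost_iff)
  \<comment> \<open>The Lipschitz bound gives (h^2)' \<le> 2 K h^2, so this weight makes the squared
    difference nonincreasing.\<close>
  let ?g = "\<lambda>t. (h t)\<^sup>2 * exp (- 2 * K * t)"
  have "?g s \<le> ?g r"
  proof (rule DERIV_nonpos_imp_decreasing_open[OF r(2)])
    fix t assume t: "r < t" "t < s"
    then have t': "t \<in> {a..<b}" "t \<in> {a<..<b}" "t \<in> {a..s}" using r s by auto
    have "(h has_real_derivative f t (u t) - f t (v t)) (at t within {a<..<b})"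
      by (rule DERIV_subset[OF D[OF t'(1)]]) auto
    then have Dt: "(h has_real_derivative f t (u t) - f t (v t)) (at t)"
      using at_within_open[OF t'(2)] by simp
    have "h t * (f t (u t) - f t (v t)) \<le> \<bar>h t\<bar> * \<bar>f t (u t) - f t (v t)\<bar>"
      by (metis abs_ge_self abs_mult)
    also have "\<dots> \<le> \<bar>h t\<bar> * (K * \<bar>h t\<bar>)"
      using K[OF t'(3), of "u t" "v t"] by (intro mult_left_mono) (auto simp: h_def)
    also have "\<dots> = K * (h t)\<^sup>2" by (simp add: power2_eq_square)
    finally have key: "h t * (f t (u t) - f t (v t)) \<le> K * (h t)\<^sup>2" .
    have "(?g has_real_derivative 2 * exp (- 2 * K * t) * (h t * (f t (u t) - f t (v t)) - K * (h t)\<^sup>2)) (at t)"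
      by (auto intro!: derivative_eq_intros Dt simp: algebra_simps)
    then show "\<exists>y. (?g has_real_derivative y) (at t) \<and> y \<le> 0"
      using key by (intro exI conjI) (auto simp: mult_le_0_iff)
  next
    have "continuous_on {r..s} h"
      by (rule continuous_on_subset[OF ch]) (use r in auto)
    then show "continuous_on {r..s} ?g" by (intro continuous_intros)
  qed
  then have "(h s)\<^sup>2 * exp (- 2 * K * s) \<le> 0" using r by simp
  then have "h s = 0" by (simp add: mult_le_0_iff)
  then show False using neg by (simp add: h_def)
qed

text \<open>Picard iteration. As the Lipschitz bound on each compact interval holds for all of the
  line, the factorial estimate gives convergence on the whole interval without shortening it, and
  one sequence of iterates serves every \<open>c < b\<close>.\<close>

lemma picard_lindeloef_global:
  fixes f :: "real \<Rightarrow> real \<Rightarrow> real"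
  assumes ab: "a < b"
    and cont: "continuous_on ({a..<b} \<times> UNIV) (\<lambda>p. f (fst p) (snd p))"
    and lip: "\<And>c. a \<le> c \<Longrightarrow> c < b \<Longrightarrow> \<exists>K. \<forall>s\<in>{a..c}. \<forall>x y. \<bar>f s x - f s y\<bar> \<le> K * \<bar>x - y\<bar>"
  shows "\<exists>x. x a = x0 \<and> (\<forall>s\<in>{a..<b}. (x has_real_derivative f s (x s)) (at s within {a..<b}))"
proof -
  define X where "X = rec_nat (\<lambda>s. x0) (\<lambda>n Y s. x0 + integral {a..s} (\<lambda>t. f t (Y t)))"
  have X0: "X 0 s = x0" and XS: "X (Suc n) s = x0 + integral {a..s} (\<lambda>t. f t (X n t))" for n s
    by (simp_all add: X_def)
  have fc: "continuous_on {a..c} (\<lambda>t. f t (Y t))" if "c < b" "continuous_on {a..c} Y" for c Y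
  proof -
    have "continuous_on {a..c} (\<lambda>t. (t, Y t))" by (intro continuous_intros that)
    moreover have "(\<lambda>t. (t, Y t)) ` {a..c} \<subseteq> {a..<b} \<times> UNIV" using that by auto
    ultimately show ?thesis using continuous_on_compose2[OF cont] by fastforce
  qed
  have Xc: "continuous_on {a..c} (X n)" if "c < b" for c n
  proof (induction n)
    case 0
    then show ?case by (simp add: X0)
  next
    case (Suc n)
    have "continuous_on {a..c} (\<lambda>s. integral {a..s} (\<lambda>t. f t (X n t)))"
      by (rule indefinite_integral_continuous_1[OF integrable_continuous_real[OF fc[OF that Suc]]])
    then show ?case unfolding XS by (intro continuous_on_add continuous_on_const)
  qed
  \<comment> \<open>The limit is written as a telescoping series so that the Weierstrass test gives
    uniform convergence.\<close>
  define x where "x = (\<lambda>s. x0 + (\<Sum>i. X (Suc i) s - X i s))"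
  have unif: "uniform_limit {a..c} X x sequentially"
    and lipc: "\<exists>K\<ge>0. \<forall>s\<in>{a..c}. \<forall>x y. \<bar>f s x - f s y\<bar> \<le> K * \<bar>x - y\<bar>"
    if c: "a \<le> c" "c < b" for c
  proof -
    obtain K' where K': "\<And>s x y. s \<in> {a..c} \<Longrightarrow> \<bar>f s x - f s y\<bar> \<le> K' * \<bar>x - y\<bar>"
      using lip[OF c] by blast
    define K where "K = max 0 K'"
    have K0: "0 \<le> K" by (simp add: K_def)
    have K: "\<bar>f s x - f s y\<bar> \<le> K * \<bar>x - y\<bar>" if "s \<in> {a..c}" for s x y
      by (rule order.trans[OF K'[OF that]]) (simp add: K_def mult_right_mono)
    show "\<exists>K\<ge>0. \<forall>s\<in>{a..c}. \<forall>x y. \<bar>f s x - f s y\<bar> \<le> K * \<bar>x - y\<bar>" using K K0 by blast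
    have "continuous_on {a..c} (\<lambda>s. X (Suc 0) s - X 0 s)"
      by (intro continuous_on_diff Xc c)
    then have "bounded ((\<lambda>s. X (Suc 0) s - X 0 s) ` {a..c})"
      by (intro compact_imp_bounded compact_continuous_image) auto
    then obtain C where C: "\<And>s. s \<in> {a..c} \<Longrightarrow> \<bar>X (Suc 0) s - X 0 s\<bar> \<le> C"
      unfolding bounded_iff by (auto simp del: atLeastAtMost_iff)
    have C0: "0 \<le> C" using C[of a] c abs_ge_zero[of "X (Suc 0) a - X 0 a"] by (simp add: order.trans)
    have bound: "\<bar>X (Suc n) s - X n s\<bar> \<le> C * (K * (s - a)) ^ n / fact n" if "s \<in> {a..c}" for n s
      using that
    proof (induction n arbitrary: s)
      case 0
      then show ?case using C by simp
    next
      case (Suc n)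
      have sc: "s < b" "a \<le> s" using Suc.prems c by auto
      have i: "(\<lambda>t. f t (X m t)) integrable_on {a..s}" for m
        by (rule integrable_continuous_real[OF fc[OF sc(1) Xc[OF sc(1)]]])
      have hi: "((\<lambda>t. K * (C * (K * (t - a)) ^ n / fact n)) has_integral
         (C * (K * (s - a)) ^ Suc n / fact (Suc n) - C * (K * (a - a)) ^ Suc n / fact (Suc n))) {a..s}"
      proof (rule fundamental_theorem_of_calculus[OF sc(2)])
        fix t
        have f: "fact (Suc n) = real (Suc n) * fact n" by simp
        have "((\<lambda>t. C * (K * (t - a)) ^ Suc n / fact (Suc n)) has_real_derivative
           (C * (real (Suc n) * (K * (t - a)) ^ n * K) / fact (Suc n))) (at t within {a..s})"
        proof -
          have "((\<lambda>t. K * (t - a)) has_real_derivative K) (at t within {a..s})"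
            by (auto intro!: derivative_eq_intros)
          from DERIV_cdivide[OF DERIV_cmult[OF DERIV_power[OF this, of "Suc n"], of C], of "fact (Suc n)"]
          show ?thesis by (simp only: diff_Suc_1 One_nat_def diff_Suc_Suc diff_zero mult.assoc mult.commute mult.left_commute)
        qed
        moreover have "C * (real (Suc n) * (K * (t - a)) ^ n * K) / fact (Suc n) = K * (C * (K * (t - a)) ^ n / fact n)"
        proof -
          have gen: "C * (N * P * K) / (N * F) = K * (C * P / F)" if "N \<noteq> 0" for N P F :: real
            using that by simp
          show ?thesis unfolding f by (rule gen) simp
        qed
        ultimately show "((\<lambda>t. C * (K * (t - a)) ^ Suc n / fact (Suc n)) has_vector_derivative
          K * (C * (K * (t - a)) ^ n / fact n)) (at t within {a..s})"
          by (simp only: has_real_derivative_iff_has_vector_derivative)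
      qed
      have "X (Suc (Suc n)) s - X (Suc n) s = integral {a..s} (\<lambda>t. f t (X (Suc n) t) - f t (X n t))"
        unfolding XS[of "Suc n"] XS[of n s] using i[of "Suc n"] i[of n] by (simp add: integral_diff)
      also have "\<bar>\<dots>\<bar> \<le> integral {a..s} (\<lambda>t. K * (C * (K * (t - a)) ^ n / fact n))"
        unfolding real_norm_def[symmetric]
      proof (rule integral_norm_bound_integral)
        show "(\<lambda>t. f t (X (Suc n) t) - f t (X n t)) integrable_on {a..s}" using i by (intro integrable_diff)
        show "(\<lambda>t. K * (C * (K * (t - a)) ^ n / fact n)) integrable_on {a..s}" using hi by blast
        fix t assume t: "t \<in> {a..s}"
        then have t': "t \<in> {a..c}" using Suc.prems by auto
        have "norm (f t (X (Suc n) t) - f t (X n t)) \<le> K * \<bar>X (Suc n) t - X n t\<bar>"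
          using K[OF t'] by simp
        also have "\<dots> \<le> K * (C * (K * (t - a)) ^ n / fact n)"
          using Suc.IH[OF t'] K0 by (intro mult_left_mono)
        finally show "norm (f t (X (Suc n) t) - f t (X n t)) \<le> K * (C * (K * (t - a)) ^ n / fact n)" .
      qed
      also have "\<dots> = C * (K * (s - a)) ^ Suc n / fact (Suc n)"
        using integral_unique[OF hi] by simp
      finally show ?case .
    qed
    have "uniform_limit {a..c} (\<lambda>n s. \<Sum>i<n. X (Suc i) s - X i s) (\<lambda>s. \<Sum>i. X (Suc i) s - X i s) sequentially"
    proof (rule Weierstrass_m_test)
      fix n s assume s: "s \<in> {a..c}"
      have "C * (K * (s - a)) ^ n / fact n \<le> C * (K * (c - a)) ^ n / fact n"
        using s K0 C0 by (intro divide_right_mono mult_left_mono power_mono) auto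
      then show "norm (X (Suc n) s - X n s) \<le> C * ((K * (c - a)) ^ n / fact n)"
        using bound[OF s, of n] by simp
    next
      show "summable (\<lambda>n. C * ((K * (c - a)) ^ n / fact n))"
        using summable_exp_generic[of "K * (c - a)"] by (intro summable_mult) (simp add: field_simps)
    qed
    then have "uniform_limit {a..c} (\<lambda>n s. x0 + (\<Sum>i<n. X (Suc i) s - X i s)) x sequentially"
      unfolding x_def by (intro uniform_limit_intros)
    moreover have "x0 + (\<Sum>i<n. X (Suc i) s - X i s) = X n s" for n s
      using sum_lessThan_telescope[of "\<lambda>i. X i s" n] X0 by simp
    ultimately show "uniform_limit {a..c} X x sequentially" by (simp only: )
  qed
  have xc: "continuous_on {a..c} x" if "a \<le> c" "c < b" for c
    by (rule uniform_limit_theorem[OF _ unif[OF that]]) (use Xc that in auto)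
  have xeq: "x s = x0 + integral {a..s} (\<lambda>t. f t (x t))" if s: "a \<le> s" "s < b" for s
  proof -
    obtain K where K0: "0 \<le> K" and K: "\<And>t x y. t \<in> {a..s} \<Longrightarrow> \<bar>f t x - f t y\<bar> \<le> K * \<bar>x - y\<bar>"
      using lipc[OF s] by blast
    have "uniform_limit {a..s} (\<lambda>n t. f t (X n t)) (\<lambda>t. f t (x t)) sequentially"
    proof (rule uniform_limitI)
      fix e :: real assume e: "0 < e"
      \<comment> \<open>Adding 1 avoids division by zero when \<open>K = 0\<close>.\<close>
      have "0 < e / (K + 1)" using e K0 by simp
      from uniform_limitD[OF unif[OF s] this]
      show "\<forall>\<^sub>F n in sequentially. \<forall>t\<in>{a..s}. dist (f t (X n t)) (f t (x t)) < e"
      proof eventually_elim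
        case (elim n)
        show ?case
        proof
          fix t assume t: "t \<in> {a..s}"
          have "dist (f t (X n t)) (f t (x t)) \<le> K * \<bar>X n t - x t\<bar>" using K[OF t] by (simp add: dist_real_def)
          also have "\<dots> \<le> (K + 1) * \<bar>X n t - x t\<bar>" by (intro mult_right_mono) auto
          also have "\<dots> < (K + 1) * (e / (K + 1))"
            using elim t K0 by (intro mult_strict_left_mono) (auto simp: dist_real_def)
          finally show "dist (f t (X n t)) (f t (x t)) < e" using K0 by simp
        qed
      qed
    qed
    then obtain I J where I: "\<And>n. ((\<lambda>t. f t (X n t)) has_integral I n) {a..s}"
      and J: "((\<lambda>t. f t (x t)) has_integral J) {a..s}" and IJ: "I \<longlonglongrightarrow> J"
      by (rule uniform_limit_integral) (use fc Xc s in auto)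
    have "(\<lambda>n. X (Suc n) s) \<longlonglongrightarrow> x0 + J"
      unfolding XS integral_unique[OF I] by (intro tendsto_intros IJ)
    moreover have "(\<lambda>n. X (Suc n) s) \<longlonglongrightarrow> x s"
      using tendsto_uniform_limitI[OF unif[OF s], of s] s by (intro LIMSEQ_Suc) auto
    ultimately show ?thesis using integral_unique[OF J] LIMSEQ_unique by blast
  qed
  have "(x has_real_derivative f s (x s)) (at s within {a..<b})" if s: "s \<in> {a..<b}" for s
  proof -
    \<comment> \<open>The midpoint gives a compact interval on which the integral equation can be
      differentiated and which agrees with \<open>{a..<b}\<close> near \<open>s\<close>.\<close>
    define c where "c = (s + b) / 2"
    have c: "a \<le> c" "s < c" "c < b" using s by (auto simp: c_def)
    have D: "((\<lambda>s. x0 + integral {a..s} (\<lambda>t. f t (x t))) has_real_derivative f s (x s)) (at s within {a..c})"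
      using DERIV_add[OF DERIV_const[of x0] integral_has_real_derivative[OF fc[OF c(3) xc[OF c(1,3)]], of s]] s c
      by simp
    have "(x has_real_derivative f s (x s)) (at s within {a..c})"
    proof (rule has_field_derivative_transform_within[OF D zero_less_one])
      show "x0 + integral {a..r} (\<lambda>t. f t (x t)) = x r" if "r \<in> {a..c}" for r
        by (rule xeq[symmetric]) (use that c in auto)
    qed (use s c in auto)
    moreover have "at s within {a..c} = at s within {a..<b}"
      by (rule at_within_nhd[of s "{..<c}"]) (use c in auto)
    ultimately show ?thesis by simp
  qed
  moreover have "x a = x0" by (subst xeq) (use ab in auto)
  ultimately show ?thesis by blast
qed

subsection \<open>The standard normal distribution function\<close>

abbreviation std_normal_cdf :: "real \<Rightarrow> real" where
  "std_normal_cdf \<equiv> cdf std_normal_distribution"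

interpretation std_normal: real_distribution std_normal_distribution
  by (rule real_dist_normal_dist)

lemma measure_std_normal_eq:
  assumes [measurable]: "A \<in> sets borel"
  shows "measure std_normal_distribution A = (\<integral>x. std_normal_density x * indicator A x \<partial>lborel)"
proof -
  have "measure std_normal_distribution A = (\<integral>x. indicator A x \<partial>std_normal_distribution)"
    by simp
  also have "\<dots> = (\<integral>x. std_normal_density x * indicator A x \<partial>lborel)"
    by (intro integral_real_density) auto
  finally show ?thesis .
qed

lemma std_normal_integrable_indicator:
  "A \<in> sets borel \<Longrightarrow> integrable lborel (\<lambda>x. std_normal_density x * indicator A x)"
  using integrable_mult_indicator[of A lborel std_normal_density]
  by (simp add: mult.commute)

text \<open>On \<open>A\<close> the standard normal density is at most exp (- c^2 / 2) times the
  density of N(c, 1), which has mass 1. The form with a general \<open>A\<close> covers the right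
  tail and, with negative \<open>c\<close>, the left tail.\<close>

lemma std_normal_tail_le:
  assumes [measurable]: "A \<in> sets borel" and A: "\<And>u. u \<in> A \<Longrightarrow> u\<^sup>2 \<ge> c\<^sup>2 + (u - c)\<^sup>2"
  shows "measure std_normal_distribution A \<le> exp (- c\<^sup>2 / 2)"
proof -
  have "measure std_normal_distribution A = (\<integral>x. std_normal_density x * indicator A x \<partial>lborel)"
    by (rule measure_std_normal_eq) simp
  also have "\<dots> \<le> (\<integral>x. exp (- c\<^sup>2 / 2) * normal_density c 1 x \<partial>lborel)"
  proof (rule integral_mono)
    fix u
    have "std_normal_density u \<le> exp (- c\<^sup>2 / 2) * normal_density c 1 u" if "u \<in> A"
    proof -
      have "exp (- u\<^sup>2 / 2) \<le> exp (- c\<^sup>2 / 2) * exp (- (u - c)\<^sup>2 / 2)"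
        unfolding exp_add[symmetric] using A[OF that] by simp
      then show ?thesis
        by (simp add: std_normal_density_def normal_density_def divide_right_mono)
    qed
    then show "std_normal_density u * indicator A u \<le> exp (- c\<^sup>2 / 2) * normal_density c 1 u"
      by (auto simp: indicator_def)
  qed (use std_normal_integrable_indicator[of A] in auto)
  also have "\<dots> = exp (- c\<^sup>2 / 2)" by simp
  finally show ?thesis .
qed

lemma std_normal_cdf_tail:
  assumes "0 \<le> z"
  shows "1 - std_normal_cdf z \<le> exp (- z\<^sup>2 / 2)"
proof -
  have "1 - std_normal_cdf z = measure std_normal_distribution (space std_normal_distribution - {..z})"
    unfolding cdf_def by (rule std_normal.prob_compl[symmetric]) simp
  also have "\<dots> \<le> exp (- z\<^sup>2 / 2)"
  proof (rule std_normal_tail_le)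
    fix u assume "u \<in> space std_normal_distribution - {..z}"
    then have "0 \<le> z * (u - z)" using assms by simp
    then show "z\<^sup>2 + (u - z)\<^sup>2 \<le> u\<^sup>2" by (simp add: power2_eq_square algebra_simps)
  qed simp
  finally show ?thesis .
qed

text \<open>Near \<open>z\<close> the distribution function is a constant plus the integral of a
  continuous density.\<close>

lemma std_normal_cdf_has_derivative:
  "(std_normal_cdf has_real_derivative std_normal_density z) (at z)"
proof -
  have c: "continuous_on S std_normal_density" for S
    unfolding std_normal_density_def by (intro continuous_intros) auto
  have D: "((\<lambda>u. std_normal_cdf (z - 1) + integral {z - 1..u} std_normal_density)
      has_real_derivative std_normal_density z) (at z within {z - 1..z + 1})"
    using DERIV_add[OF DERIV_const[of "std_normal_cdf (z - 1)"]
        integral_has_real_derivative[OF c, of z "z - 1" "z + 1"]] by simp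
  have "(std_normal_cdf has_real_derivative std_normal_density z) (at z within {z - 1..z + 1})"
  proof (rule has_field_derivative_transform_within[OF D zero_less_one])
    fix u assume u: "u \<in> {z - 1..z + 1}"
    show "std_normal_cdf (z - 1) + integral {z - 1..u} std_normal_density = std_normal_cdf u"
    proof (cases "z - 1 = u")
      case False
      then have "std_normal_cdf u - std_normal_cdf (z - 1) = measure std_normal_distribution {z - 1<..u}"
        using u by (intro std_normal.cdf_diff_eq) auto
      also have "\<dots> = (\<integral>x. std_normal_density x * indicator {z - 1<..u} x \<partial>lborel)"
        by (rule measure_std_normal_eq) simp
      also have "\<dots> = (\<integral>x. indicator {z - 1..u} x *\<^sub>R std_normal_density x \<partial>lborel)"
      proof (rule integral_cong_AE)
        show "AE x in lborel. std_normal_density x * indicator {z - 1<..u} x = indicator {z - 1..u} x *\<^sub>R std_normal_density x"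
          using AE_lborel_singleton[of "z - 1"] by eventually_elim (auto simp: indicator_def)
      qed auto
      also have "\<dots> = integral {z - 1..u} std_normal_density"
        unfolding set_lebesgue_integral_def[symmetric]
        using std_normal_integrable_indicator[of "{z - 1..u}"]
        by (intro set_borel_integral_eq_integral) (simp add: set_integrable_def mult.commute)
      finally show ?thesis by simp
    qed (simp add: )
  qed auto
  then have "(std_normal_cdf has_real_derivative std_normal_density z) (at z within {z - 1<..<z + 1})"
    by (rule DERIV_subset) auto
  then show ?thesis using at_within_open[of z "{z - 1<..<z + 1}"] by simp
qed

lemma std_normal_cdf_measurable [measurable]: "std_normal_cdf \<in> borel_measurable borel"
  by (intro borel_measurable_continuous_onI DERIV_continuous_on)
     (auto intro: std_normal_cdf_has_derivative has_field_derivative_at_within)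

lemma std_normal_cdf_mvt:
  assumes "a < b"
  obtains c where "a < c" "c < b" "std_normal_cdf b - std_normal_cdf a = (b - a) * std_normal_density c"
proof -
  obtain c where "a < c" "c < b" "std_normal_cdf b - std_normal_cdf a = (b - a) * std_normal_density c"
    using MVT2[OF assms, of std_normal_cdf std_normal_density] std_normal_cdf_has_derivative by blast
  then show ?thesis using that by blast
qed

lemma std_normal_density_pos: "0 < std_normal_density z"
  by (simp add: std_normal_density_def)

lemma std_normal_density_le_1: "std_normal_density z \<le> 1"
proof -
  have "exp (- z\<^sup>2 / 2) \<le> 1" by simp
  moreover have "1 \<le> sqrt (2 * pi)" using pi_ge_two by simp
  ultimately have "1 / sqrt (2 * pi) * exp (- z\<^sup>2 / 2) \<le> 1 * 1" by (intro mult_mono) auto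
  then show ?thesis by (simp add: std_normal_density_def)
qed

lemma std_normal_cdf_pos: "0 < std_normal_cdf z"
proof -
  obtain c where "std_normal_cdf z - std_normal_cdf (z - 1) = (z - (z - 1)) * std_normal_density c"
    by (rule std_normal_cdf_mvt[of "z - 1" z]) auto
  then show ?thesis
    using std_normal_density_pos[of c] std_normal.cdf_nonneg[of "z - 1"] by simp
qed

text \<open>A Mills-ratio bound, from the mass of an interval of length \<open>1 / (1 + \<bar>z\<bar>)\<close> to the right of \<open>z\<close>.\<close>
lemma std_normal_density_le_tail:
  "std_normal_density z \<le> exp (3/2) * (1 + \<bar>z\<bar>) * (1 - std_normal_cdf z)"
proof -
  define h where "h = 1 / (1 + \<bar>z\<bar>)"
  have h: "0 < h" "h \<le> 1" "h * (1 + \<bar>z\<bar>) = 1" by (auto simp: h_def field_simps add_pos_nonneg)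
  obtain c where c: "z < c" "c < z + h"
    "std_normal_cdf (z + h) - std_normal_cdf z = (z + h - z) * std_normal_density c"
    by (rule std_normal_cdf_mvt[of z "z + h"]) (use h in auto)
  \<comment> \<open>Since \<open>h * (1 + \<bar>z\<bar>) = 1\<close>, the squares differ by at most
    3 on the interval, so the density falls by a factor of at most exp (3/2).\<close>
  have "c\<^sup>2 - z\<^sup>2 = (c - z) * (c + z)" by (simp add: power2_eq_square algebra_simps)
  also have "\<dots> \<le> (c - z) * (2 * \<bar>z\<bar> + h)" using c by (intro mult_left_mono) auto
  also have "\<dots> \<le> h * (2 * \<bar>z\<bar> + h)" using c h by (intro mult_right_mono) auto
  also have "\<dots> \<le> h * (2 * (1 + \<bar>z\<bar>))" using h by (intro mult_left_mono) auto
  also have "\<dots> \<le> 3" using h(3) by (simp add: algebra_simps)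
  finally have "exp (- z\<^sup>2 / 2) \<le> exp (3/2) * exp (- c\<^sup>2 / 2)"
    unfolding exp_add[symmetric] by (simp add: field_simps)
  then have "std_normal_density z \<le> exp (3/2) * std_normal_density c"
    by (simp add: std_normal_density_def divide_right_mono)
  also have "\<dots> = exp (3/2) * ((1 + \<bar>z\<bar>) * h) * std_normal_density c" using h(3) by (simp add: mult.commute)
  also have "\<dots> = exp (3/2) * (1 + \<bar>z\<bar>) * (std_normal_cdf (z + h) - std_normal_cdf z)"
    unfolding c(3) by (simp add: algebra_simps)
  also have "\<dots> \<le> exp (3/2) * (1 + \<bar>z\<bar>) * (1 - std_normal_cdf z)"
    using std_normal.cdf_bounded_prob[of "z + h"] by (intro mult_left_mono) auto
  finally show ?thesis .
qed

lemma std_normal_cdf_less_1: "std_normal_cdf z < 1"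
proof -
  have "0 < exp (3/2) * (1 + \<bar>z\<bar>) * (1 - std_normal_cdf z)"
    using std_normal_density_le_tail[of z] std_normal_density_pos[of z] by linarith
  moreover have "0 < exp (3/2) * (1 + \<bar>z\<bar>)" by (simp add: add_pos_nonneg)
  ultimately show ?thesis by (metis zero_less_mult_pos diff_gt_0_iff_gt)
qed

subsection \<open>The guided flow\<close>

lemma one_minus_square_pos:
  assumes "0 \<le> s" "s < (1::real)"
  shows "0 < 1 - s\<^sup>2"
  using assms by (simp add: abs_square_less_1)

text \<open>From (1 + u/3)^3 \<le> exp u. The third power is the one that absorbs the blow-up of the
  hazard rate as s tends to 1.\<close>

lemma cube_le_exp:
  assumes "0 \<le> (u::real)"
  shows "u ^ 3 \<le> 27 * exp u"
proof -
  have "(u / 3) ^ 3 \<le> (1 + u / 3) ^ 3" using assms by (intro power_mono) auto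
  also have "\<dots> \<le> exp u" using exp_ge_one_plus_x_over_n_power_n[of 3 u] assms by simp
  finally show ?thesis by (simp add: power_divide)
qed

text \<open>Expanding the square in the Gaussian kernel separates a factor free of \<open>y\<close>
  from an exponential tilt of \<open>q\<close>.\<close>

lemma noised_density_eq_tilt:
  assumes q: "prob_density_on q lo hi" and t: "t < T"
  defines "s \<equiv> exp (t - T)"
  shows "noised_density q T t x =
    exp (- x\<^sup>2 / (2 * (1 - s\<^sup>2))) / sqrt (2 * pi * (1 - s\<^sup>2)) * tilt q 0 (s * x / (1 - s\<^sup>2)) (s\<^sup>2 / (2 * (1 - s\<^sup>2)))"
proof -
  define B where "B = 1 - s\<^sup>2"
  have "s < 1" "0 < s" using t by (auto simp: s_def)
  then have B: "0 < B" using one_minus_square_pos[of s] by (simp add: B_def)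
  have k: "normal_density (s * y) (sqrt B) x
      = exp (- x\<^sup>2 / (2 * B)) / sqrt (2 * pi * B) * (y ^ 0 * exp (s * x / B * y - s\<^sup>2 / (2 * B) * y\<^sup>2))" for y
  proof -
    have "- (x - s * y)\<^sup>2 / (2 * B) = - x\<^sup>2 / (2 * B) + (s * x / B * y - s\<^sup>2 / (2 * B) * y\<^sup>2)"
      using B by (simp add: field_simps power2_eq_square)
    then have "exp (- (x - s * y)\<^sup>2 / (2 * B)) = exp (- x\<^sup>2 / (2 * B)) * exp (s * x / B * y - s\<^sup>2 / (2 * B) * y\<^sup>2)"
      by (simp only: exp_add)
    then show ?thesis using B by (simp add: normal_density_def)
  qed
  have "noised_density q T t x = (\<integral>y. q y * normal_density (s * y) (sqrt B) x \<partial>lborel)"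
    by (simp add: noised_density_def sched_a_def sched_b_def s_def B_def)
  also have "\<dots> = (\<integral>y. exp (- x\<^sup>2 / (2 * B)) / sqrt (2 * pi * B) *
       (q y * (y ^ 0 * exp (s * x / B * y - s\<^sup>2 / (2 * B) * y\<^sup>2))) \<partial>lborel)"
    unfolding k by (simp only: mult.left_commute)
  also have "\<dots> = exp (- x\<^sup>2 / (2 * B)) / sqrt (2 * pi * B) * tilt q 0 (s * x / B) (s\<^sup>2 / (2 * B))"
    unfolding tilt_def by (rule integral_mult_right_zero)
  finally show ?thesis by (simp only: B_def)
qed

text \<open>Tweedie's formula.\<close>
lemma noised_density_score:
  assumes q: "prob_density_on q lo hi" and t: "t < T"
  defines "s \<equiv> exp (t - T)"
  shows "deriv (\<lambda>y. ln (noised_density q T t y)) x =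
    (s * tilt_mean q (s * x / (1 - s\<^sup>2)) (s\<^sup>2 / (2 * (1 - s\<^sup>2))) - x) / (1 - s\<^sup>2)"
proof -
  define B where "B = 1 - s\<^sup>2"
  define c where "c = s\<^sup>2 / (2 * B)"
  have "s < 1" "0 < s" using t by (auto simp: s_def)
  then have B: "0 < B" using one_minus_square_pos[of s] by (simp add: B_def)
  \<comment> \<open>The logarithm splits into a quadratic, a constant and the log of a tilt, whose
    derivatives are immediate.\<close>
  have eq: "(\<lambda>y. ln (noised_density q T t y)) = (\<lambda>y. (- y\<^sup>2 / (2 * B) - ln (sqrt (2 * pi * B))) + ln (tilt q 0 (s * y / B) c))"
  proof
    fix y
    have "sqrt (2 * pi * B) > 0" using B by simp
    moreover have "tilt q 0 (s * y / B) c > 0" by (rule tilt_pos[OF q])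
    moreover have "noised_density q T t y = exp (- y\<^sup>2 / (2 * B)) / sqrt (2 * pi * B) * tilt q 0 (s * y / B) c"
      unfolding noised_density_eq_tilt[OF q t] B_def s_def c_def ..
    ultimately show "ln (noised_density q T t y) = (- y\<^sup>2 / (2 * B) - ln (sqrt (2 * pi * B))) + ln (tilt q 0 (s * y / B) c)"
      by (simp only: ln_mult ln_div ln_exp) (auto simp: less_le)
  qed
  have tp: "tilt q 0 (s * x / B) c > 0" by (rule tilt_pos[OF q])
  have "((\<lambda>y. s * y / B) has_real_derivative s / B) (at x)"
    using B by (auto intro!: derivative_eq_intros)
  from DERIV_chain2[OF tilt_has_derivative[OF q, of 0 c "s * x / B"] this]
  have "((\<lambda>y. tilt q 0 (s * y / B) c) has_real_derivative tilt q 1 (s * x / B) c * (s / B)) (at x)" by simp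
  from DERIV_chain2[OF DERIV_ln[OF tp] this]
  have D1: "((\<lambda>y. ln (tilt q 0 (s * y / B) c)) has_real_derivative
      inverse (tilt q 0 (s * x / B) c) * (tilt q 1 (s * x / B) c * (s / B))) (at x)" .
  have D2: "((\<lambda>y. - y\<^sup>2 / (2 * B) - ln (sqrt (2 * pi * B))) has_real_derivative - x / B) (at x)"
    using B by (auto intro!: derivative_eq_intros simp: field_simps)
  have "deriv (\<lambda>y. ln (noised_density q T t y)) x = - x / B + inverse (tilt q 0 (s * x / B) c) * (tilt q 1 (s * x / B) c * (s / B))"
    unfolding eq by (rule DERIV_imp_deriv[OF DERIV_add[OF D2 D1]])
  also have "\<dots> = (s * tilt_mean q (s * x / B) c - x) / B"
    using B tp unfolding tilt_mean_def by (simp add: field_simps)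
  finally show ?thesis unfolding c_def B_def .
qed

section \<open>The mixture and its guided field in the time variable s\<close>

locale guided_mixture =
  fixes p1 pm1 :: "real \<Rightarrow> real" and \<alpha>1 \<alpha>2 \<beta> w :: real
  assumes \<alpha>1_pos: "0 < \<alpha>1" and \<alpha>1_less: "\<alpha>1 < \<alpha>2" and \<beta>_ge: "\<beta> \<ge> 1" and w_pos: "0 < w"
    and p1: "prob_density_on p1 \<alpha>1 \<alpha>2"
    and pm1: "prob_density_on pm1 (-\<alpha>2) (-\<alpha>1)"
    and ratio: "\<And>x1 x2. x1 \<in> {-\<alpha>2<..<-\<alpha>1} \<Longrightarrow> x2 \<in> {\<alpha>1<..<\<alpha>2} \<Longrightarrow>
           1/\<beta> \<le> pm1 x1 / p1 x2 \<and> pm1 x1 / p1 x2 \<le> \<beta>"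
begin

text \<open>Treating the mixture as one density on [-\<alpha>2, \<alpha>2] makes all results on
  tilts apply to it.\<close>

definition mix :: "real \<Rightarrow> real" where "mix y = (p1 y + pm1 y) / 2"

lemma mix: "prob_density_on mix (-\<alpha>2) \<alpha>2"
  using prob_density_onD[OF p1] prob_density_onD[OF pm1] \<alpha>1_pos \<alpha>1_less
  unfolding prob_density_on_def mix_def by auto

lemma tilt_mix: "tilt mix j l c = (tilt p1 j l c + tilt pm1 j l c) / 2"
proof -
  have "(\<lambda>y. mix y * (y ^ j * exp (l * y - c * y\<^sup>2)))
    = (\<lambda>y. (p1 y * (y ^ j * exp (l * y - c * y\<^sup>2)) + pm1 y * (y ^ j * exp (l * y - c * y\<^sup>2))) / 2)"
    by (auto simp: mix_def fun_eq_iff field_simps)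
  then show ?thesis
    using tilt_integrable[OF p1, of j l c] tilt_integrable[OF pm1, of j l c]
    by (simp add: tilt_def)
qed

lemma mixture_noised_density_eq:
  assumes "t < T"
  shows "mixture_noised_density p1 pm1 T t = noised_density mix T t"
  unfolding mixture_noised_density_def fun_eq_iff noised_density_eq_tilt[OF p1 assms]
    noised_density_eq_tilt[OF pm1 assms] noised_density_eq_tilt[OF mix assms] tilt_mix
  by (simp only: add_divide_distrib distrib_left times_divide_eq_right times_divide_eq_left mult_1 divide_divide_eq_left mult.commute mult.left_commute) simp

text \<open>Posterior means of \<open>X_0\<close> given \<open>X_t = x\<close>, with and without conditioning on \<open>z = 1\<close>, at \<open>s = a_t\<close>.\<close>
definition mean1 :: "real \<Rightarrow> real \<Rightarrow> real" where
  "mean1 s x = tilt_mean p1 (s * x / (1 - s\<^sup>2)) (s\<^sup>2 / (2 * (1 - s\<^sup>2)))"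

definition mean :: "real \<Rightarrow> real \<Rightarrow> real" where
  "mean s x = tilt_mean mix (s * x / (1 - s\<^sup>2)) (s\<^sup>2 / (2 * (1 - s\<^sup>2)))"

definition guidance :: "real \<Rightarrow> real \<Rightarrow> real" where
  "guidance s x = w * (mean1 s x - mean s x)"

text \<open>The right-hand side of the guided ODE divided by ds/dt = s.\<close>

definition vel :: "real \<Rightarrow> real \<Rightarrow> real" where
  "vel s x = (mean1 s x + guidance s x - s * x) / (1 - s\<^sup>2)"

definition flow :: "real \<Rightarrow> (real \<Rightarrow> real) \<Rightarrow> bool" where
  "flow s0 y \<longleftrightarrow> (\<forall>s\<in>{s0..<1}. (y has_real_derivative vel s (y s)) (at s within {s0..<1}))"

text \<open>In the scores the terms in \<open>x\<close> add up to - x / (1 - s^2); together with the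
  drift \<open>x\<close> they leave - s^2 x / (1 - s^2), so a factor s comes out of the whole
  field.\<close>

lemma guided_field_eq:
  assumes "t < T"
  shows "x + (w + 1) * deriv (\<lambda>y. ln (noised_density p1 T t y)) x
           - w * deriv (\<lambda>y. ln (mixture_noised_density p1 pm1 T t y)) x = exp (t - T) * vel (exp (t - T)) x"
proof -
  define s where "s = exp (t - T)"
  have "s < 1" "0 < s" using assms by (auto simp: s_def)
  then have B: "1 - s\<^sup>2 > 0" using one_minus_square_pos[of s] by simp
  have 1: "deriv (\<lambda>y. ln (noised_density p1 T t y)) x = (s * mean1 s x - x) / (1 - s\<^sup>2)"
    unfolding noised_density_score[OF p1 assms] mean1_def s_def ..
  have 2: "deriv (\<lambda>y. ln (mixture_noised_density p1 pm1 T t y)) x = (s * mean s x - x) / (1 - s\<^sup>2)"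
    unfolding mixture_noised_density_eq[OF assms] noised_density_score[OF mix assms] mean_def s_def ..
  have "x + (w + 1) * ((s * M1 - x) / B) - w * ((s * M - x) / B) = s * ((M1 + w * (M1 - M) - s * x) / B)"
    if "B = 1 - s\<^sup>2" "B > 0" for B M M1
  proof -
    have "x = x * B / B" using that by simp
    also have "\<dots> = (x - s * s * x) / B" unfolding that(1) by (simp add: algebra_simps power2_eq_square)
    finally have "x + (w + 1) * ((s * M1 - x) / B) - w * ((s * M - x) / B)
      = (x - s * s * x) / B + (w + 1) * ((s * M1 - x) / B) - w * ((s * M - x) / B)" by simp
    also have "\<dots> = s * ((M1 + w * (M1 - M) - s * x) / B)"
      using that(2) by (simp add: field_simps)
    finally show ?thesis .
  qed
  from this[OF refl B] show ?thesis
    unfolding 1 2 vel_def guidance_def s_def[symmetric] .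
qed

lemma guided_flow_solution_iff:
  assumes "0 < T"
  shows "guided_flow_solution p1 pm1 T w x0 x \<longleftrightarrow>
    x 0 = x0 \<and> (\<forall>t\<in>{0..<T}. (x has_real_derivative exp (t - T) * vel (exp (t - T)) (x t)) (at t within {0..<T}))"
  unfolding guided_flow_solution_def by (simp add: guided_field_eq)

text \<open>Chain rule along \<open>exp (t - T)\<close>; this direction provides the existence of
  guided solutions.\<close>

lemma flow_imp_guided:
  assumes T: "0 < T" and y: "flow (exp (- T)) y"
  shows "guided_flow_solution p1 pm1 T w (y (exp (- T))) (\<lambda>t. y (exp (t - T)))"
  unfolding guided_flow_solution_iff[OF T]
proof (intro conjI ballI)
  fix t assume t: "t \<in> {0..<T}"
  have "(y has_real_derivative vel (exp (t - T)) (y (exp (t - T)))) (at (exp (t - T)) within {exp (- T)..<1})"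
    using y t unfolding flow_def by auto
  then have "(y has_real_derivative vel (exp (t - T)) (y (exp (t - T)))) (at (exp (t - T)) within (\<lambda>t. exp (t - T)) ` {0..<T})"
    by (rule DERIV_subset) auto
  moreover have "((\<lambda>t. exp (t - T)) has_real_derivative exp (t - T)) (at t within {0..<T})"
    by (auto intro!: derivative_eq_intros)
  ultimately show "((\<lambda>t. y (exp (t - T))) has_real_derivative exp (t - T) * vel (exp (t - T)) (y (exp (t - T)))) (at t within {0..<T})"
    using DERIV_image_chain[of y "vel (exp (t - T)) (y (exp (t - T)))" "\<lambda>t. exp (t - T)" t "{0..<T}" "exp (t - T)"]
    by (simp only: o_def mult.commute)
qed simp

text \<open>The inverse substitution, by which an arbitrary guided solution becomes subject to the
  results on \<open>flow\<close>.\<close>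

lemma guided_imp_flow:
  assumes T: "0 < T" and x: "guided_flow_solution p1 pm1 T w x0 x"
  shows "flow (exp (- T)) (\<lambda>s. x (T + ln s))"
  unfolding flow_def
proof
  fix s assume s: "s \<in> {exp (- T)..<1}"
  then have s0: "0 < s" using exp_gt_zero[of "- T"] by (simp del: exp_gt_zero)
  have im: "(\<lambda>s. T + ln s) ` {exp (- T)..<1} \<subseteq> {0..<T}"
  proof safe
    fix r assume r: "r \<in> {exp (- T)..<1}"
    then have r0: "0 < r" using exp_gt_zero[of "- T"] by (simp del: exp_gt_zero)
    have "- T \<le> ln r" using r r0 by (simp add: ln_ge_iff)
    then show "T + ln r \<in> {0..<T}" using r r0 by simp
  qed
  have "(x has_real_derivative s * vel s (x (T + ln s))) (at (T + ln s) within {0..<T})"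
    using x im s s0 unfolding guided_flow_solution_iff[OF T] by force
  from DERIV_subset[OF this im]
  have "(x has_real_derivative s * vel s (x (T + ln s))) (at (T + ln s) within (\<lambda>s. T + ln s) ` {exp (- T)..<1})" .
  moreover have "((\<lambda>s. T + ln s) has_real_derivative 1 / s) (at s within {exp (- T)..<1})"
    using s0 by (auto intro!: derivative_eq_intros)
  ultimately have "((\<lambda>s. x (T + ln s)) has_real_derivative s * vel s (x (T + ln s)) * (1 / s)) (at s within {exp (- T)..<1})"
    using DERIV_image_chain[of x "s * vel s (x (T + ln s))" "\<lambda>s. T + ln s" s "{exp (- T)..<1}" "1 / s"]
    by (simp only: o_def)
  then show "((\<lambda>s. x (T + ln s)) has_real_derivative vel s (x (T + ln s))) (at s within {exp (- T)..<1})"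
    using s0 by simp
qed

section \<open>Existence and order of trajectories\<close>

lemma vel_lipschitz:
  assumes c: "0 < s0" "s0 \<le> c" "c < 1"
  shows "\<exists>K. \<forall>s\<in>{s0..c}. \<forall>x y. \<bar>vel s x - vel s y\<bar> \<le> K * \<bar>x - y\<bar>"
proof (intro exI ballI allI)
  fix s x y assume s: "s \<in> {s0..c}"
  define B where "B = 1 - s\<^sup>2"
  define D where "D = 1 - c\<^sup>2"
  have s1: "0 < s" "s < 1" using s c by auto
  have D: "0 < D" using one_minus_square_pos[of c] c by (simp add: D_def)
  have "s\<^sup>2 \<le> c\<^sup>2" using s s1 by (intro power_mono) auto
  then have BD: "D \<le> B" by (simp add: B_def D_def)
  then have B: "0 < B" using D by simp
  \<comment> \<open>Both \<open>p1\<close> and \<open>mix\<close> live within distance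
    \<open>\<alpha>2\<close> of 0, so one Lipschitz constant serves both posterior means.\<close>
  have R: "max \<bar>\<alpha>1\<bar> \<bar>\<alpha>2\<bar> = \<alpha>2" "max \<bar>- \<alpha>2\<bar> \<bar>\<alpha>2\<bar> = \<alpha>2" using \<alpha>1_pos \<alpha>1_less by auto
  have l: "\<bar>s * x / B - s * y / B\<bar> \<le> \<bar>x - y\<bar> / D"
  proof -
    have "\<bar>s * x / B - s * y / B\<bar> = s * \<bar>x - y\<bar> / B"
      using B s1 by (simp add: diff_divide_distrib[symmetric] right_diff_distrib[symmetric] abs_mult abs_divide)
    also have "\<dots> \<le> 1 * \<bar>x - y\<bar> / D"
      using s1 BD D by (intro frac_le mult_right_mono) auto
    finally show ?thesis by simp
  qed
  have L: "\<bar>M (s * x / B) - M (s * y / B)\<bar> \<le> 2 * \<alpha>2\<^sup>2 * (\<bar>x - y\<bar> / D)"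
    if "\<And>l l'. \<bar>M l - M l'\<bar> \<le> 2 * \<alpha>2\<^sup>2 * \<bar>l - l'\<bar>" for M :: "real \<Rightarrow> real"
    by (rule order.trans[OF that]) (use l in \<open>intro mult_left_mono, auto\<close>)
  let ?E = "2 * \<alpha>2\<^sup>2 * (\<bar>x - y\<bar> / D)"
  have 1: "\<bar>mean1 s x - mean1 s y\<bar> \<le> ?E"
    unfolding mean1_def B_def[symmetric] by (rule L) (use tilt_mean_lipschitz[OF p1] R in auto)
  have 2: "\<bar>mean s x - mean s y\<bar> \<le> ?E"
    unfolding mean_def B_def[symmetric] by (rule L) (use tilt_mean_lipschitz[OF mix] R in auto)
  have "vel s x - vel s y = ((w + 1) * (mean1 s x - mean1 s y) - w * (mean s x - mean s y) - s * (x - y)) / B"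
    unfolding vel_def guidance_def B_def[symmetric] by (simp add: diff_divide_distrib[symmetric] algebra_simps)
  then have "\<bar>vel s x - vel s y\<bar> = \<bar>(w + 1) * (mean1 s x - mean1 s y) - w * (mean s x - mean s y) - s * (x - y)\<bar> / B"
    using B by (simp add: abs_divide)
  also have "\<dots> \<le> ((w + 1) * ?E + w * ?E + 1 * \<bar>x - y\<bar>) / D"
  proof (rule frac_le)
    have "\<bar>(w + 1) * (mean1 s x - mean1 s y)\<bar> \<le> (w + 1) * ?E"
      unfolding abs_mult using 1 w_pos by (intro mult_mono) auto
    moreover have "\<bar>w * (mean s x - mean s y)\<bar> \<le> w * ?E"
      unfolding abs_mult using 2 w_pos by (intro mult_mono) auto
    moreover have "\<bar>s * (x - y)\<bar> \<le> 1 * \<bar>x - y\<bar>"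
      unfolding abs_mult using s1 by (intro mult_right_mono) auto
    ultimately show "\<bar>(w + 1) * (mean1 s x - mean1 s y) - w * (mean s x - mean s y) - s * (x - y)\<bar>
        \<le> (w + 1) * ?E + w * ?E + 1 * \<bar>x - y\<bar>" by linarith
  qed (use BD D w_pos in auto)
  also have "\<dots> = (((w + 1) * (2 * \<alpha>2\<^sup>2 / D) + w * (2 * \<alpha>2\<^sup>2 / D) + 1) / D) * \<bar>x - y\<bar>"
    using D by (simp add: field_simps)
  finally show "\<bar>vel s x - vel s y\<bar> \<le> (((w + 1) * (2 * \<alpha>2\<^sup>2 / (1 - c\<^sup>2)) + w * (2 * \<alpha>2\<^sup>2 / (1 - c\<^sup>2)) + 1) / (1 - c\<^sup>2)) * \<bar>x - y\<bar>"
    unfolding D_def .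
qed

lemma continuous_on_vel:
  assumes "0 < s0"
  shows "continuous_on ({s0..<1} \<times> UNIV) (\<lambda>p. vel (fst p) (snd p))"
proof -
  let ?l = "\<lambda>p::real \<times> real. (fst p * snd p / (1 - (fst p)\<^sup>2), (fst p)\<^sup>2 / (2 * (1 - (fst p)\<^sup>2)))"
  have nz: "1 - (fst p)\<^sup>2 \<noteq> 0" if "p \<in> {s0..<1} \<times> UNIV" for p :: "real \<times> real"
    using one_minus_square_pos[of "fst p"] that assms by auto
  have l: "continuous_on ({s0..<1} \<times> UNIV) ?l"
    using nz by (intro continuous_intros) auto
  have M: "continuous_on ({s0..<1} \<times> UNIV) (\<lambda>p. tilt_mean q (fst (?l p)) (snd (?l p)))"
    if "prob_density_on q lo hi" for q lo hi
    by (rule continuous_on_compose2[OF continuous_on_tilt_mean[OF that] l]) auto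
  have "continuous_on ({s0..<1} \<times> UNIV) (\<lambda>p. mean1 (fst p) (snd p))"
    using M[OF p1] by (simp add: mean1_def)
  moreover have "continuous_on ({s0..<1} \<times> UNIV) (\<lambda>p. mean (fst p) (snd p))"
    using M[OF mix] by (simp add: mean_def)
  ultimately show ?thesis
    unfolding vel_def guidance_def using nz by (intro continuous_intros) auto
qed

lemma flow_exists:
  assumes "0 < s0" "s0 < 1"
  shows "\<exists>y. y s0 = x0 \<and> flow s0 y"
  unfolding flow_def
  by (rule picard_lindeloef_global[OF assms(2) continuous_on_vel[OF assms(1)]]) (rule vel_lipschitz[OF assms(1)])

lemma flow_mono:
  assumes "0 < s0" "flow s0 u" "flow s0 v" "u s0 \<le> v s0" "s \<in> {s0..<1}"
  shows "u s \<le> v s"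
  by (rule ode_order_preserving[of s0 1 vel])
     (use assms vel_lipschitz[OF assms(1)] in \<open>auto simp: flow_def\<close>)

lemma flow_continuous_on:
  assumes "flow s0 y"
  shows "continuous_on {s0..<1} y"
  using assms unfolding flow_def by (intro DERIV_continuous_on) auto

lemma flow_vel_continuous_on:
  assumes "0 < s0" "flow s0 y"
  shows "continuous_on {s0..<1} (\<lambda>s. vel s (y s))"
proof -
  have "continuous_on {s0..<1} (\<lambda>s. (s, y s))"
    using flow_continuous_on[OF assms(2)] by (intro continuous_intros)
  moreover have "(\<lambda>s. (s, y s)) ` {s0..<1} \<subseteq> {s0..<1} \<times> UNIV" by auto
  ultimately show ?thesis using continuous_on_compose2[OF continuous_on_vel[OF assms(1)]] by fastforce
qed

subsection \<open>Bounds on the guidance\<close>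

lemma density_ratio:
  assumes "x1 \<in> {-\<alpha>2<..<-\<alpha>1}" "x2 \<in> {\<alpha>1<..<\<alpha>2}"
  shows "0 < p1 x2" "p1 x2 \<le> \<beta> * pm1 x1" "pm1 x1 \<le> \<beta> * p1 x2"
proof -
  have b: "0 < \<beta>" using \<beta>_ge by simp
  have r: "1 / \<beta> \<le> pm1 x1 / p1 x2" "pm1 x1 / p1 x2 \<le> \<beta>" using ratio[OF assms] by auto
  have "0 < 1 / \<beta>" using b by simp
  \<comment> \<open>Division by zero yields 0, so the positive lower bound on the ratio excludes a
    vanishing denominator.\<close>
  then have "p1 x2 \<noteq> 0" using r(1) by auto
  then show p: "0 < p1 x2" using prob_density_onD(2)[OF p1, of x2] by simp
  show "p1 x2 \<le> \<beta> * pm1 x1" "pm1 x1 \<le> \<beta> * p1 x2" using r p b by (simp_all add: field_simps)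
qed

text \<open>Reflection moves the class -1 onto the support of \<open>p1\<close>, so that the two
  tilts can be compared pointwise.\<close>

lemma tilt_pm1_reflect:
  "tilt pm1 0 l c = (\<integral>y. pm1 (- y) * exp (- l * y - c * y\<^sup>2) \<partial>lborel)"
  "integrable lborel (\<lambda>y. pm1 (- y) * exp (- l * y - c * y\<^sup>2))"
proof -
  show "tilt pm1 0 l c = (\<integral>y. pm1 (- y) * exp (- l * y - c * y\<^sup>2) \<partial>lborel)"
    unfolding tilt_def by (subst lborel_integral_real_affine[where c = "-1" and t = 0]) auto
  show "integrable lborel (\<lambda>y. pm1 (- y) * exp (- l * y - c * y\<^sup>2))"
    using lborel_integrable_real_affine[OF tilt_integrable[OF pm1, of 0 l c], of "-1" 0] by simp
qed

text \<open>The density ratio is controlled only on open intervals; the endpoints form a null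
  set.\<close>

lemma AE_interior_or_outside: "AE y in lborel. y \<in> {\<alpha>1<..<\<alpha>2} \<or> y \<notin> {\<alpha>1..\<alpha>2}"
  using AE_lborel_singleton[of \<alpha>1] AE_lborel_singleton[of \<alpha>2] by eventually_elim auto

text \<open>After reflection the exponentials differ by exp (2 l y), which is largest at
  \<open>y = \<alpha>2\<close> for positive \<open>l\<close> and at most 1 otherwise; the densities
  contribute \<open>\<beta>\<close>.\<close>

lemma tilt_p1_le: "tilt p1 0 l c \<le> \<beta> * exp (2 * max l 0 * \<alpha>2) * tilt pm1 0 l c"
proof -
  have i: "integrable lborel (\<lambda>y. p1 y * exp (l * y - c * y\<^sup>2))"
    using tilt_integrable[OF p1, of 0 l c] by simp
  have "tilt p1 0 l c = (\<integral>y. p1 y * exp (l * y - c * y\<^sup>2) \<partial>lborel)" by (simp add: tilt_def)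
  also have "\<dots> \<le> (\<integral>y. (\<beta> * exp (2 * max l 0 * \<alpha>2)) * (pm1 (- y) * exp (- l * y - c * y\<^sup>2)) \<partial>lborel)"
  proof (rule integral_mono_AE[OF i])
    show "integrable lborel (\<lambda>y. (\<beta> * exp (2 * max l 0 * \<alpha>2)) * (pm1 (- y) * exp (- l * y - c * y\<^sup>2)))"
      by (rule integrable_mult_right) (rule tilt_pm1_reflect)
    show "AE y in lborel. p1 y * exp (l * y - c * y\<^sup>2)
       \<le> (\<beta> * exp (2 * max l 0 * \<alpha>2)) * (pm1 (- y) * exp (- l * y - c * y\<^sup>2))"
      using AE_interior_or_outside
    proof eventually_elim
      case (elim y)
      show ?case
      proof (cases "y \<in> {\<alpha>1<..<\<alpha>2}")
        case True
        have "l * y \<le> max l 0 * \<alpha>2"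
          using True \<alpha>1_pos by (intro mult_mono) auto
        then have "exp (l * y - c * y\<^sup>2) \<le> exp (2 * max l 0 * \<alpha>2) * exp (- l * y - c * y\<^sup>2)"
          unfolding exp_add[symmetric] by simp
        moreover have "p1 y \<le> \<beta> * pm1 (- y)" using density_ratio(2)[of "- y" y] True by simp
        ultimately have "p1 y * exp (l * y - c * y\<^sup>2) \<le> (\<beta> * pm1 (- y)) * (exp (2 * max l 0 * \<alpha>2) * exp (- l * y - c * y\<^sup>2))"
          using prob_density_onD(2)[OF p1, of y] by (intro mult_mono) auto
        then show ?thesis by (simp only: ac_simps)
      next
        case False
        then have "p1 y = 0" using elim prob_density_onD(5)[OF p1] by auto
        then show ?thesis using \<beta>_ge prob_density_onD(2)[OF pm1, of "- y"] by simp
      qed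
    qed
  qed
  also have "\<dots> = \<beta> * exp (2 * max l 0 * \<alpha>2) * tilt pm1 0 l c"
    unfolding tilt_pm1_reflect(1) by (rule integral_mult_right_zero)
  finally show ?thesis .
qed

text \<open>For nonnegative \<open>l\<close> the factor exp (- 2 l y) is largest at
  \<open>y = \<alpha>1\<close>.\<close>

lemma tilt_pm1_le:
  assumes "0 \<le> l"
  shows "tilt pm1 0 l c \<le> \<beta> * exp (- 2 * l * \<alpha>1) * tilt p1 0 l c"
proof -
  have i: "integrable lborel (\<lambda>y. p1 y * exp (l * y - c * y\<^sup>2))"
    using tilt_integrable[OF p1, of 0 l c] by simp
  have "tilt pm1 0 l c = (\<integral>y. pm1 (- y) * exp (- l * y - c * y\<^sup>2) \<partial>lborel)"
    by (rule tilt_pm1_reflect)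
  also have "\<dots> \<le> (\<integral>y. (\<beta> * exp (- 2 * l * \<alpha>1)) * (p1 y * exp (l * y - c * y\<^sup>2)) \<partial>lborel)"
  proof (rule integral_mono_AE[OF tilt_pm1_reflect(2)])
    show "integrable lborel (\<lambda>y. (\<beta> * exp (- 2 * l * \<alpha>1)) * (p1 y * exp (l * y - c * y\<^sup>2)))"
      by (rule integrable_mult_right) (rule i)
    show "AE y in lborel. pm1 (- y) * exp (- l * y - c * y\<^sup>2)
       \<le> (\<beta> * exp (- 2 * l * \<alpha>1)) * (p1 y * exp (l * y - c * y\<^sup>2))"
      using AE_interior_or_outside
    proof eventually_elim
      case (elim y)
      show ?case
      proof (cases "y \<in> {\<alpha>1<..<\<alpha>2}")
        case True
        have "l * \<alpha>1 \<le> l * y" using True assms by (intro mult_left_mono) auto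
        then have "exp (- l * y - c * y\<^sup>2) \<le> exp (- 2 * l * \<alpha>1) * exp (l * y - c * y\<^sup>2)"
          unfolding exp_add[symmetric] by simp
        moreover have "pm1 (- y) \<le> \<beta> * p1 y" using density_ratio(3)[of "- y" y] True by simp
        ultimately have "pm1 (- y) * exp (- l * y - c * y\<^sup>2) \<le> (\<beta> * p1 y) * (exp (- 2 * l * \<alpha>1) * exp (l * y - c * y\<^sup>2))"
          using prob_density_onD(2)[OF p1, of y] \<beta>_ge by (intro mult_mono) auto
        then show ?thesis by (simp only: ac_simps)
      next
        case False
        then have "pm1 (- y) = 0" using elim by (intro prob_density_onD(5)[OF pm1]) auto
        then show ?thesis using \<beta>_ge prob_density_onD(2)[OF p1, of "y"] by simp
      qed
    qed
  qed
  also have "\<dots> = \<beta> * exp (- 2 * l * \<alpha>1) * tilt p1 0 l c"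
    unfolding tilt_def by (subst integral_mult_right_zero) simp
  finally show ?thesis .
qed

text \<open>The mixture mean is a convex combination of the class means, so the difference is the
  posterior probability B / (A + B) of class -1 times the gap \<open>d\<close> between the class
  means, which lies between 2 \<alpha>1 and 2 \<alpha>2.\<close>

lemma mean_diff_bounds:
  shows "\<alpha>1 / (\<beta> * exp (2 * max l 0 * \<alpha>2)) \<le> tilt_mean p1 l c - tilt_mean mix l c"
    and "0 \<le> l \<Longrightarrow> tilt_mean p1 l c - tilt_mean mix l c \<le> 2 * \<alpha>2 * \<beta> * exp (- 2 * l * \<alpha>1)"
proof -
  define A where "A = tilt p1 0 l c"
  define B where "B = tilt pm1 0 l c"
  define E where "E = \<beta> * exp (2 * max l 0 * \<alpha>2)"
  have pos: "0 < A" "0 < B" unfolding A_def B_def by (rule tilt_pos[OF p1] tilt_pos[OF pm1])+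
  have "1 * 1 \<le> \<beta> * exp (2 * max l 0 * \<alpha>2)"
    using \<beta>_ge \<alpha>1_pos \<alpha>1_less by (intro mult_mono) auto
  then have E: "1 \<le> E" by (simp add: E_def)
  have AE: "A \<le> E * B" unfolding A_def B_def E_def by (rule tilt_p1_le)
  have "B \<le> E * B" using E pos mult_right_mono[of 1 E B] by simp
  then have sum: "A + B \<le> 2 * E * B" using AE by simp
  define d where "d = tilt_mean p1 l c - tilt_mean pm1 l c"
  have d: "2 * \<alpha>1 \<le> d" "d \<le> 2 * \<alpha>2"
    using tilt_mean_bounds[OF p1, of l c] tilt_mean_bounds[OF pm1, of l c] by (auto simp: d_def)
  have eq: "tilt_mean p1 l c - tilt_mean mix l c = B / (A + B) * d"
  proof -
    have "A1 / A - ((A1 + B1) / 2) / ((A + B) / 2) = B / (A + B) * (A1 / A - B1 / B)" for A1 B1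
    proof -
      have "A + B \<noteq> 0" using pos by simp
      then show ?thesis using pos by (simp add: divide_simps) (simp add: algebra_simps)
    qed
    then show ?thesis unfolding d_def tilt_mean_def tilt_mix A_def B_def .
  qed
  have "1 / (2 * E) \<le> B / (A + B)" using sum pos E by (simp add: field_simps)
  then have "1 / (2 * E) * (2 * \<alpha>1) \<le> B / (A + B) * d"
    using d pos E \<alpha>1_pos by (intro mult_mono) auto
  then show "\<alpha>1 / (\<beta> * exp (2 * max l 0 * \<alpha>2)) \<le> tilt_mean p1 l c - tilt_mean mix l c"
    unfolding eq E_def by simp
  show "tilt_mean p1 l c - tilt_mean mix l c \<le> 2 * \<alpha>2 * \<beta> * exp (- 2 * l * \<alpha>1)" if "0 \<le> l"
  proof -
    have "B / (A + B) \<le> B / A" using pos by (intro divide_left_mono) auto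
    also have "\<dots> \<le> \<beta> * exp (- 2 * l * \<alpha>1)"
      using tilt_pm1_le[OF that, of c] pos by (simp add: A_def B_def pos_divide_le_eq)
    finally have "B / (A + B) * d \<le> (\<beta> * exp (- 2 * l * \<alpha>1)) * (2 * \<alpha>2)"
      using d pos \<alpha>1_pos \<beta>_ge by (intro mult_mono) auto
    then show ?thesis unfolding eq by (simp only: ac_simps)
  qed
qed

lemma guidance_ge:
  "w * \<alpha>1 / (\<beta> * exp (2 * max (s * x / (1 - s\<^sup>2)) 0 * \<alpha>2)) \<le> guidance s x"
  using mult_left_mono[OF mean_diff_bounds(1), of w "s * x / (1 - s\<^sup>2)" "s\<^sup>2 / (2 * (1 - s\<^sup>2))"] w_pos
  unfolding guidance_def mean1_def mean_def by simp

lemma guidance_nonneg: "0 \<le> guidance s x"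
  using guidance_ge[of s x] w_pos \<alpha>1_pos \<beta>_ge
  by (smt (verit) divide_nonneg_nonneg exp_ge_zero mult_nonneg_nonneg)

lemma guidance_le:
  assumes "0 \<le> s * x / (1 - s\<^sup>2)"
  shows "guidance s x \<le> 2 * \<alpha>2 * \<beta> * w * exp (- 2 * (s * x / (1 - s\<^sup>2)) * \<alpha>1)"
  using mult_left_mono[OF mean_diff_bounds(2)[OF assms], of w "s\<^sup>2 / (2 * (1 - s\<^sup>2))"] w_pos
  unfolding guidance_def mean1_def mean_def by (simp add: ac_simps)

subsection \<open>Quantiles along the flow\<close>

text \<open>Given X_0 = y, the event X_t \<le> x says that a standard normal variable is at most
  this number.\<close>

definition std_arg :: "real \<Rightarrow> real \<Rightarrow> real \<Rightarrow> real" where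
  "std_arg s x y = (x - s * y) / sqrt (1 - s\<^sup>2)"

text \<open>\<open>quantile s x\<close> is \<open>P(X_t \<le> x | z = 1)\<close>. The unguided flow for \<open>p1\<close> transports it, so along the
  guided flow its growth is driven by the guidance term alone.\<close>
definition quantile :: "real \<Rightarrow> real \<Rightarrow> real" where
  "quantile s x = (\<integral>y. p1 y * std_normal_cdf (std_arg s x y) \<partial>lborel)"

text \<open>This is sqrt (1 - s^2) times the density of X_t given z = 1; the missing factor is
  accounted for in the derivative along the flow.\<close>

definition quantile_density :: "real \<Rightarrow> real \<Rightarrow> real" where
  "quantile_density s x = (\<integral>y. p1 y * std_normal_density (std_arg s x y) \<partial>lborel)"

lemma std_arg_measurable [measurable]: "std_arg s x \<in> borel_measurable borel"
  unfolding std_arg_def[abs_def] by measurable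

lemma quantile_integrable:
  "integrable lborel (\<lambda>y. p1 y * std_normal_cdf (std_arg s x y))"
  by (rule prob_density_on_integrable_mult[OF p1, where C = 1])
     (auto simp: std_normal.cdf_nonneg std_normal.cdf_bounded_prob)

lemma quantile_mono:
  assumes "x \<le> x'" "0 \<le> s" "s < 1"
  shows "quantile s x \<le> quantile s x'"
  unfolding quantile_def
proof (rule prob_density_on_integral_mono[OF p1 quantile_integrable quantile_integrable])
  fix y
  show "std_normal_cdf (std_arg s x y) \<le> std_normal_cdf (std_arg s x' y)"
    using assms one_minus_square_pos[of s]
    by (intro std_normal.cdf_nondecreasing) (auto simp: std_arg_def divide_right_mono)
qed

lemma quantile_compl:
  "1 - quantile s x = (\<integral>y. p1 y * (1 - std_normal_cdf (std_arg s x y)) \<partial>lborel)"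
  using quantile_integrable[of s x] prob_density_onD(3,4)[OF p1]
  by (simp add: quantile_def right_diff_distrib)

lemma quantile_pos: "0 < quantile s x"
  unfolding quantile_def
  by (rule prob_density_on_integral_pos[OF p1 quantile_integrable]) (rule std_normal_cdf_pos)

lemma quantile_less_1: "quantile s x < 1"
proof -
  have "integrable lborel (\<lambda>y. p1 y * (1 - std_normal_cdf (std_arg s x y)))"
    using quantile_integrable[of s x] prob_density_onD(3)[OF p1] by (simp add: right_diff_distrib)
  then have "0 < 1 - quantile s x"
    unfolding quantile_compl
    by (rule prob_density_on_integral_pos[OF p1]) (simp add: std_normal_cdf_less_1)
  then show ?thesis by simp
qed

lemma std_normal_density_std_arg:
  assumes "0 \<le> s" "s < 1"
  shows "std_normal_density (std_arg s x y) = exp (- x\<^sup>2 / (2 * (1 - s\<^sup>2))) / sqrt (2 * pi) *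
    exp (s * x / (1 - s\<^sup>2) * y - s\<^sup>2 / (2 * (1 - s\<^sup>2)) * y\<^sup>2)"
proof -
  define B where "B = 1 - s\<^sup>2"
  have B: "0 < B" using one_minus_square_pos[OF assms] by (simp add: B_def)
  have "- (std_arg s x y)\<^sup>2 / 2 = - x\<^sup>2 / (2 * B) + (s * x / B * y - s\<^sup>2 / (2 * B) * y\<^sup>2)"
    unfolding std_arg_def B_def[symmetric] power_divide using B
    by (simp add: field_simps power2_eq_square)
  then show ?thesis
    unfolding std_normal_density_def B_def[symmetric] by (simp only: exp_add) simp
qed

text \<open>The cases \<open>j = 0\<close> and \<open>j = 1\<close> identify \<open>mean1\<close> as
  a ratio of Gaussian-weighted integrals.\<close>

lemma quantile_density_tilt:
  assumes "0 \<le> s" "s < 1"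
  shows "(\<integral>y. p1 y * (y ^ j * std_normal_density (std_arg s x y)) \<partial>lborel)
    = exp (- x\<^sup>2 / (2 * (1 - s\<^sup>2))) / sqrt (2 * pi) * tilt p1 j (s * x / (1 - s\<^sup>2)) (s\<^sup>2 / (2 * (1 - s\<^sup>2)))"
  unfolding std_normal_density_std_arg[OF assms] tilt_def
  by (subst integral_mult_right_zero[symmetric]) (simp only: ac_simps)

text \<open>Differentiation under the integral sign leaves the weight (1 - s^2) y' + s y - z. By the
  form of \<open>vel\<close> this is \<open>mean1 + guidance - z\<close>, and
  \<open>mean1 - z\<close> integrates to zero because \<open>mean1\<close> is the mean under exactly
  this weighting.\<close>

lemma quantile_flow_has_derivative:
  assumes s0: "0 < s0" and y: "flow s0 y" and s: "s \<in> {s0..<1}"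
  shows "((\<lambda>s. quantile s (y s)) has_real_derivative
     quantile_density s (y s) * guidance s (y s) / (sqrt (1 - s\<^sup>2)) ^ 3) (at s within {s0..<1})"
proof -
  \<comment> \<open>Stopping at a midpoint keeps 1 - r^2 away from zero and makes \<open>y\<close>
    and its velocity bounded.\<close>
  define c where "c = (s + 1) / 2"
  have c: "s < c" "c < 1" "0 < c" "s0 \<le> c" using s s0 by (auto simp: c_def)
  let ?S = "{s0..c}"
  have sub: "?S \<subseteq> {s0..<1}" using c by auto
  have "bounded (y ` ?S)"
    by (intro compact_imp_bounded compact_continuous_image continuous_on_subset[OF flow_continuous_on[OF y] sub]) simp
  then obtain U where U: "\<And>r. r \<in> ?S \<Longrightarrow> \<bar>y r\<bar> \<le> U" unfolding bounded_iff by (auto simp del: atLeastAtMost_iff)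
  have "bounded ((\<lambda>r. vel r (y r)) ` ?S)"
    by (intro compact_imp_bounded compact_continuous_image continuous_on_subset[OF flow_vel_continuous_on[OF s0 y] sub]) simp
  then obtain V where V: "\<And>r. r \<in> ?S \<Longrightarrow> \<bar>vel r (y r)\<bar> \<le> V" unfolding bounded_iff by (auto simp del: atLeastAtMost_iff)
  let ?k' = "\<lambda>r z. std_normal_density (std_arg r (y r) z) * (((1 - r\<^sup>2) * vel r (y r) + r * y r - z) / (sqrt (1 - r\<^sup>2)) ^ 3)"
  let ?C = "1 * ((V + U + \<alpha>2) / (sqrt (1 - c\<^sup>2)) ^ 3)"
  have Dc: "0 < 1 - c\<^sup>2" using one_minus_square_pos[of c] c by simp
  have "((\<lambda>r. quantile r (y r)) has_real_derivative (\<integral>z. p1 z * ?k' s z \<partial>lborel)) (at s within ?S)"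
    unfolding quantile_def
  proof (rule prob_density_on_has_derivative_integral[OF p1, where C = ?C])
    show "convex ?S" "s \<in> ?S" using s c by auto
    fix r z assume r: "r \<in> ?S" and z: "z \<in> {\<alpha>1..\<alpha>2}"
    define B where "B = 1 - r\<^sup>2"
    have r1: "0 \<le> r" "r < 1" using r c s0 by auto
    have B: "0 < B" using one_minus_square_pos[OF r1] by (simp add: B_def)
    have "r\<^sup>2 \<le> c\<^sup>2" using r r1 by (intro power_mono) auto
    then have Bc: "1 - c\<^sup>2 \<le> B" by (simp add: B_def)
    have yD: "(y has_real_derivative vel r (y r)) (at r within ?S)"
      using y r sub unfolding flow_def by (intro DERIV_subset[OF _ sub]) auto
    have bD: "((\<lambda>r. sqrt (1 - r\<^sup>2)) has_real_derivative - r / sqrt B) (at r within ?S)"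
      using B unfolding B_def by (auto intro!: derivative_eq_intros simp: field_simps)
    have "((\<lambda>r. std_arg r (y r) z) has_real_derivative
       ((vel r (y r) - z) * sqrt B - (y r - r * z) * (- r / sqrt B)) / (sqrt B * sqrt B)) (at r within ?S)"
      unfolding std_arg_def[abs_def] B_def
      by (rule DERIV_divide[OF _ bD[unfolded B_def]])
         (use B yD in \<open>auto intro!: derivative_eq_intros simp: B_def\<close>)
    also have "((vel r (y r) - z) * sqrt B - (y r - r * z) * (- r / sqrt B)) / (sqrt B * sqrt B)
       = (B * vel r (y r) + r * y r - z) / (sqrt B) ^ 3"
    proof -
      define b where "b = sqrt B"
      have b: "b > 0" "b * b = B" using B by (auto simp: b_def)
      have "((v - z) * b - (u - r * z) * (- r / b)) / (b * b) = ((v - z) * (b * b) + r * (u - r * z)) / b ^ 3" for u v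
        using b(1) by (simp add: field_simps power3_eq_cube)
      also have "\<dots> u v = (B * v + r * u - z) / b ^ 3" for u v
        unfolding b(2) by (simp add: B_def algebra_simps power2_eq_square)
      finally show ?thesis unfolding b_def[symmetric] .
    qed
    finally have zD: "((\<lambda>r. std_arg r (y r) z) has_real_derivative (B * vel r (y r) + r * y r - z) / (sqrt B) ^ 3) (at r within ?S)" .
    show "((\<lambda>r. std_normal_cdf (std_arg r (y r) z)) has_real_derivative ?k' r z) (at r within ?S)"
      using DERIV_chain2[OF std_normal_cdf_has_derivative zD] unfolding B_def .
    have "\<bar>B * vel r (y r) + r * y r - z\<bar> \<le> 1 * V + 1 * U + \<alpha>2"
    proof -
      have "\<bar>B * vel r (y r)\<bar> \<le> 1 * V" unfolding abs_mult using B V[OF r] by (intro mult_mono) (auto simp: B_def)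
      moreover have "\<bar>r * y r\<bar> \<le> 1 * U" unfolding abs_mult using r1 U[OF r] by (intro mult_mono) auto
      moreover have "\<bar>z\<bar> \<le> \<alpha>2" using z \<alpha>1_pos by auto
      ultimately show ?thesis by linarith
    qed
    then have "\<bar>(B * vel r (y r) + r * y r - z) / (sqrt B) ^ 3\<bar> \<le> (V + U + \<alpha>2) / (sqrt (1 - c\<^sup>2)) ^ 3"
      unfolding abs_divide using Bc Dc B by (intro frac_le) (auto intro!: power_mono)
    then show "\<bar>?k' r z\<bar> \<le> ?C"
      unfolding abs_mult B_def
      using std_normal_density_le_1[of "std_arg r (y r) z"] std_normal_density_pos[of "std_arg r (y r) z"]
      by (intro mult_mono) auto
  next
    show "integrable lborel (\<lambda>z. p1 z * std_normal_cdf (std_arg r (y r) z))" for r by (rule quantile_integrable)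
  qed measurable
  also have "(\<integral>z. p1 z * ?k' s z \<partial>lborel) = quantile_density s (y s) * guidance s (y s) / (sqrt (1 - s\<^sup>2)) ^ 3"
  proof -
    have s1: "0 \<le> s" "s < 1" using s s0 by auto
    define B where "B = 1 - s\<^sup>2"
    have B: "0 < B" using one_minus_square_pos[OF s1] by (simp add: B_def)
    define e where "e = exp (- (y s)\<^sup>2 / (2 * (1 - s\<^sup>2))) / sqrt (2 * pi)"
    define T0 where "T0 = tilt p1 0 (s * y s / (1 - s\<^sup>2)) (s\<^sup>2 / (2 * (1 - s\<^sup>2)))"
    define T1 where "T1 = tilt p1 1 (s * y s / (1 - s\<^sup>2)) (s\<^sup>2 / (2 * (1 - s\<^sup>2)))"
    have T0: "0 < T0" unfolding T0_def by (rule tilt_pos[OF p1])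
    define g where "g = guidance s (y s)"
    define \<phi> where "\<phi> z = std_normal_density (std_arg s (y s) z)" for z
    have i0: "integrable lborel (\<lambda>z. p1 z * \<phi> z)"
      unfolding \<phi>_def by (rule prob_density_on_integrable_mult[OF p1, where C = 1])
         (auto simp: std_normal_density_le_1)
    have i1: "integrable lborel (\<lambda>z. p1 z * (z * \<phi> z))"
    proof (rule prob_density_on_integrable_mult[OF p1, where C = "\<alpha>2 * 1"])
      fix z assume z: "z \<in> {\<alpha>1..\<alpha>2}"
      show "\<bar>z * \<phi> z\<bar> \<le> \<alpha>2 * 1" unfolding abs_mult \<phi>_def
        using z \<alpha>1_pos std_normal_density_le_1 by (intro mult_mono) auto
    qed (simp add: \<phi>_def)
    have J0: "(\<integral>z. p1 z * \<phi> z \<partial>lborel) = e * T0"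
      using quantile_density_tilt[OF s1, of 0 "y s"] by (simp add: e_def T0_def \<phi>_def)
    have J1: "(\<integral>z. p1 z * (z * \<phi> z) \<partial>lborel) = e * T1"
      using quantile_density_tilt[OF s1, of 1 "y s"] by (simp add: e_def T1_def \<phi>_def)
    \<comment> \<open>This identity cancels the unguided part of the derivative.\<close>
    have m: "T1 = mean1 s (y s) * T0" using T0 by (simp add: mean1_def tilt_mean_def T0_def T1_def)
    have v: "(1 - s\<^sup>2) * vel s (y s) + s * y s = mean1 s (y s) + g"
      using B unfolding vel_def B_def g_def by simp
    have "(\<lambda>z. p1 z * ?k' s z) = (\<lambda>z. ((mean1 s (y s) + g) * (p1 z * \<phi> z) - p1 z * (z * \<phi> z)) / (sqrt B) ^ 3)"
      unfolding v B_def \<phi>_def by (auto simp: fun_eq_iff diff_divide_distrib algebra_simps)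
    then have "(\<integral>z. p1 z * ?k' s z \<partial>lborel) = ((mean1 s (y s) + g) * (e * T0) - e * T1) / (sqrt B) ^ 3"
      using i0 i1 J0 J1 by simp
    also have "\<dots> = (e * T0) * g / (sqrt B) ^ 3" unfolding m by (simp add: algebra_simps)
    finally show ?thesis using J0 by (simp add: quantile_density_def \<phi>_def g_def B_def)
  qed
  finally have "((\<lambda>s. quantile s (y s)) has_real_derivative
     quantile_density s (y s) * guidance s (y s) / (sqrt (1 - s\<^sup>2)) ^ 3) (at s within ?S)" .
  moreover have "at s within ?S = at s within {s0..<1}"
    by (rule at_within_nhd[of s "{..<c}"]) (use c in auto)
  ultimately show ?thesis by simp
qed

text \<open>Every factor of the derivative along the flow is nonnegative, the guidance in
  particular.\<close>

lemma quantile_flow_mono: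
  assumes s0: "0 < s0" and y: "flow s0 y" and r: "s0 \<le> r" "r \<le> s" "s < 1"
  shows "quantile r (y r) \<le> quantile s (y s)"
proof (rule DERIV_nonneg_imp_increasing_open[OF r(2)])
  fix t assume t: "r < t" "t < s"
  have "((\<lambda>s. quantile s (y s)) has_real_derivative
     quantile_density t (y t) * guidance t (y t) / (sqrt (1 - t\<^sup>2)) ^ 3) (at t within {s0<..<1})"
    by (rule DERIV_subset[OF quantile_flow_has_derivative[OF s0 y]]) (use t r in auto)
  then have "((\<lambda>s. quantile s (y s)) has_real_derivative
     quantile_density t (y t) * guidance t (y t) / (sqrt (1 - t\<^sup>2)) ^ 3) (at t)"
    using at_within_open[of t "{s0<..<1}"] t r by simp
  moreover have "0 \<le> quantile_density t (y t)"
    unfolding quantile_density_def using prob_density_onD(2)[OF p1] by (intro Bochner_Integration.integral_nonneg) auto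
  moreover have "0 < 1 - t\<^sup>2" using one_minus_square_pos[of t] t r s0 by simp
  ultimately show "\<exists>d. ((\<lambda>s. quantile s (y s)) has_real_derivative d) (at t) \<and> 0 \<le> d"
    using guidance_nonneg[of t "y t"]
    by (intro exI[of _ "quantile_density t (y t) * guidance t (y t) / (sqrt (1 - t\<^sup>2)) ^ 3"] conjI) auto
next
  have "continuous_on {s0..<1} (\<lambda>s. quantile s (y s))"
    by (rule DERIV_continuous_on) (rule quantile_flow_has_derivative[OF s0 y])
  then show "continuous_on {r..s} (\<lambda>s. quantile s (y s))"
    by (rule continuous_on_subset) (use r in auto)
qed

text \<open>A hazard rate bound: the Mills-ratio estimate is integrated over \<open>y\<close>, with
  \<open>\<bar>x - s * y\<bar> \<le> x + \<alpha>2\<close> making its factor uniform on the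
  support.\<close>

lemma quantile_density_le:
  assumes "0 \<le> s" "s < 1" "0 \<le> x"
  shows "quantile_density s x \<le> exp (3/2) * (1 + (x + \<alpha>2) / sqrt (1 - s\<^sup>2)) * (1 - quantile s x)"
proof -
  define K where "K = exp (3/2) * (1 + (x + \<alpha>2) / sqrt (1 - s\<^sup>2))"
  have B: "0 < 1 - s\<^sup>2" using one_minus_square_pos assms by simp
  have "quantile_density s x \<le> (\<integral>y. p1 y * (K * (1 - std_normal_cdf (std_arg s x y))) \<partial>lborel)"
    unfolding quantile_density_def
  proof (rule prob_density_on_integral_mono[OF p1])
    show "integrable lborel (\<lambda>y. p1 y * std_normal_density (std_arg s x y))"
      by (rule prob_density_on_integrable_mult[OF p1, where C = 1]) (auto simp: std_normal_density_le_1)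
    show "integrable lborel (\<lambda>y. p1 y * (K * (1 - std_normal_cdf (std_arg s x y))))"
    proof (rule prob_density_on_integrable_mult[OF p1, where C = "\<bar>K\<bar> * 1"])
      fix y
      show "\<bar>K * (1 - std_normal_cdf (std_arg s x y))\<bar> \<le> \<bar>K\<bar> * 1"
        unfolding abs_mult using std_normal_cdf_pos[of "std_arg s x y"] std_normal_cdf_less_1[of "std_arg s x y"]
        by (intro mult_left_mono) auto
    qed measurable
    fix y assume y: "y \<in> {\<alpha>1..\<alpha>2}"
    have "\<bar>x - s * y\<bar> \<le> x + \<alpha>2"
    proof -
      have "s * y \<le> 1 * \<alpha>2" using y assms \<alpha>1_pos by (intro mult_mono) auto
      moreover have "0 \<le> s * y" using y assms \<alpha>1_pos by auto
      ultimately show ?thesis using assms by linarith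
    qed
    then have "\<bar>std_arg s x y\<bar> \<le> (x + \<alpha>2) / sqrt (1 - s\<^sup>2)"
      unfolding std_arg_def abs_divide using B by (simp add: divide_right_mono)
    then have "exp (3/2) * (1 + \<bar>std_arg s x y\<bar>) * (1 - std_normal_cdf (std_arg s x y)) \<le> K * (1 - std_normal_cdf (std_arg s x y))"
      unfolding K_def using std_normal_cdf_less_1[of "std_arg s x y"]
      by (intro mult_right_mono mult_left_mono) auto
    then show "std_normal_density (std_arg s x y) \<le> K * (1 - std_normal_cdf (std_arg s x y))"
      using std_normal_density_le_tail[of "std_arg s x y"] by linarith
  qed
  also have "\<dots> = (\<integral>y. K * (p1 y * (1 - std_normal_cdf (std_arg s x y))) \<partial>lborel)"
    by (simp only: mult.left_commute)
  also have "\<dots> = K * (1 - quantile s x)"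
    unfolding quantile_compl by (rule integral_mult_right_zero)
  finally show ?thesis unfolding K_def .
qed

text \<open>Once \<open>x\<close> is bounded away from 0, the guidance decays like \<open>exp (- \<alpha>1 x / (1 - s\<^sup>2))\<close>, which beats
  the polynomial blow-up of the hazard rate.\<close>
lemma quantile_flow_rate_le:
  assumes c: "0 < c"
  shows "\<exists>C\<ge>0. \<forall>s x. 1/2 \<le> s \<longrightarrow> s < 1 \<longrightarrow> c \<le> x \<longrightarrow>
    quantile_density s x * guidance s x / (sqrt (1 - s\<^sup>2)) ^ 3 \<le> C * (1 - quantile s x)"
proof (intro exI conjI allI impI)
  \<comment> \<open>Chosen so that 1 + x + \<alpha>2 \<le> k x whenever x \<ge> c.\<close>
  define k where "k = 1 + (1 + \<alpha>2) / c"
  let ?C = "2 * \<alpha>2 * \<beta> * w * exp (3/2) * (27 * k / (c\<^sup>2 * \<alpha>1 ^ 3))"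
  have k: "1 \<le> k" using c \<alpha>1_pos \<alpha>1_less by (simp add: k_def)
  show "0 \<le> ?C" using c k \<alpha>1_pos \<alpha>1_less \<beta>_ge w_pos by simp
  fix s x :: real assume s: "1/2 \<le> s" "s < 1" and x: "c \<le> x"
  define B where "B = 1 - s\<^sup>2"
  define b where "b = sqrt B"
  have B: "0 < B" "B \<le> 1" using one_minus_square_pos[of s] s by (auto simp: B_def)
  have b: "0 < b" "b \<le> 1" "b\<^sup>2 = B" using B by (auto simp: b_def)
  have x0: "0 < x" using x c by simp
  \<comment> \<open>Since 2 s \<ge> 1, the guidance decays at least like exp (- u).\<close>
  define u where "u = x * \<alpha>1 / B"
  have u: "0 < u" using x0 \<alpha>1_pos B by (simp add: u_def)
  define N where "N = 1 - quantile s x"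
  have N: "0 < N" using quantile_less_1 by (simp add: N_def)
  have J: "quantile_density s x \<le> exp (3/2) * (1 + (x + \<alpha>2) / b) * N"
    using quantile_density_le[of s x] s x0 by (simp add: N_def b_def B_def)
  have "guidance s x \<le> 2 * \<alpha>2 * \<beta> * w * exp (- 2 * (s * x / (1 - s\<^sup>2)) * \<alpha>1)"
    by (rule guidance_le) (use s x0 B in \<open>simp add: B_def\<close>)
  also have "\<dots> \<le> 2 * \<alpha>2 * \<beta> * w * exp (- u)"
  proof -
    have "1 * x \<le> (2 * s) * x" using s x0 by (intro mult_right_mono) auto
    then have "x * \<alpha>1 / B \<le> (2 * s) * x * \<alpha>1 / B"
      using \<alpha>1_pos B by (intro divide_right_mono mult_right_mono) auto
    then have "- 2 * (s * x / (1 - s\<^sup>2)) * \<alpha>1 \<le> - u" by (simp add: u_def B_def)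
    then show ?thesis using \<alpha>1_pos \<alpha>1_less \<beta>_ge w_pos by (intro mult_left_mono) auto
  qed
  finally have g: "guidance s x \<le> 2 * \<alpha>2 * \<beta> * w * exp (- u)" .
  have h: "(1 + (x + \<alpha>2) / b) / b ^ 3 * exp (- u) \<le> 27 * k / (c\<^sup>2 * \<alpha>1 ^ 3)"
  proof -
    have "(1 + (x + \<alpha>2) / b) / b ^ 3 \<le> ((1 + x + \<alpha>2) / b) / b ^ 3"
    proof (rule divide_right_mono)
      have "1 \<le> 1 / b" using b by simp
      then show "1 + (x + \<alpha>2) / b \<le> (1 + x + \<alpha>2) / b" by (simp add: add_divide_distrib)
    qed (use b in auto)
    also have "\<dots> = (1 + x + \<alpha>2) / B\<^sup>2"
      unfolding b(3)[symmetric] by (simp add: power2_eq_square power3_eq_cube mult.assoc)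
    also have "\<dots> \<le> (x * k) / B\<^sup>2"
    proof (rule divide_right_mono)
      have "(1 + \<alpha>2) \<le> x * ((1 + \<alpha>2) / c)"
        using x c \<alpha>1_pos \<alpha>1_less mult_right_mono[of c x "(1 + \<alpha>2) / c"] by simp
      then show "1 + x + \<alpha>2 \<le> x * k" by (simp add: k_def algebra_simps)
    qed simp
    \<comment> \<open>Three powers of \<open>u\<close> bring 1 / B^3, one more than needed; the
      spare \<open>B\<close> is at most 1 and the remaining 1 / x^2 is at most 1 / c^2.\<close>
    also have "x * k / B\<^sup>2 = u ^ 3 * (k * B / (x\<^sup>2 * \<alpha>1 ^ 3))"
      using B x0 \<alpha>1_pos unfolding u_def by (simp add: field_simps power2_eq_square power3_eq_cube)
    also have "\<dots> \<le> u ^ 3 * (k * 1 / (c\<^sup>2 * \<alpha>1 ^ 3))"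
      using u k B x c \<alpha>1_pos by (intro mult_left_mono frac_le mult_right_mono power_mono) auto
    also have "\<dots> \<le> (27 * exp u) * (k * 1 / (c\<^sup>2 * \<alpha>1 ^ 3))"
      using cube_le_exp[of u] u k c \<alpha>1_pos by (intro mult_right_mono) auto
    finally have "(1 + (x + \<alpha>2) / b) / b ^ 3 * exp (- u) \<le> ((27 * exp u) * (k * 1 / (c\<^sup>2 * \<alpha>1 ^ 3))) * exp (- u)"
      by (intro mult_right_mono) auto
    also have "\<dots> = 27 * k / (c\<^sup>2 * \<alpha>1 ^ 3)" by (simp add: exp_minus)
    finally show ?thesis .
  qed
  have "quantile_density s x * guidance s x / b ^ 3
     \<le> (exp (3/2) * (1 + (x + \<alpha>2) / b) * N) * (2 * \<alpha>2 * \<beta> * w * exp (- u)) / b ^ 3"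
    using J g guidance_nonneg[of s x] N b x0 \<alpha>1_pos \<alpha>1_less
    by (intro divide_right_mono mult_mono) auto
  also have "\<dots> = (2 * \<alpha>2 * \<beta> * w * exp (3/2)) * ((1 + (x + \<alpha>2) / b) / b ^ 3 * exp (- u)) * N"
    by (simp only: times_divide_eq_left times_divide_eq_right ac_simps)
  also have "\<dots> \<le> ?C * N"
    using h N \<alpha>1_pos \<alpha>1_less \<beta>_ge w_pos by (intro mult_right_mono mult_left_mono) auto
  finally show "quantile_density s x * guidance s x / (sqrt (1 - s\<^sup>2)) ^ 3 \<le> ?C * (1 - quantile s x)"
    unfolding N_def b_def B_def .
qed

subsection \<open>The limit of the flow\<close>

definition cdf1 :: "real \<Rightarrow> real" where
  "cdf1 c = (\<integral>y. p1 y * indicator {..c} y \<partial>lborel)"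

lemma cdf1_integrable:
  "A \<in> sets borel \<Longrightarrow> integrable lborel (\<lambda>y. p1 y * indicator A y)"
  by (rule prob_density_on_integrable_mult[OF p1, where C = 1]) (auto simp: indicator_def)

text \<open>With \<open>y\<close> fixed, the ratio bounds are integrated over the reflected support,
  where \<open>pm1\<close> has mass 1 and the length is \<alpha>2 - \<alpha>1.\<close>

lemma p1_bounds:
  assumes y: "y \<in> {\<alpha>1<..<\<alpha>2}"
  shows "1 / (\<beta> * (\<alpha>2 - \<alpha>1)) \<le> p1 y" "p1 y \<le> \<beta> / (\<alpha>2 - \<alpha>1)"
proof -
  have d: "0 < \<alpha>2 - \<alpha>1" using \<alpha>1_less by simp
  have AE: "AE x in lborel. x \<in> {-\<alpha>2<..<-\<alpha>1} \<or> x \<notin> {-\<alpha>2..-\<alpha>1}"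
    using AE_lborel_singleton[of "-\<alpha>1"] AE_lborel_singleton[of "-\<alpha>2"] by eventually_elim auto
  have int: "(\<integral>x. c * indicator {-\<alpha>2..-\<alpha>1} x \<partial>lborel) = c * (\<alpha>2 - \<alpha>1)" for c :: real
    using \<alpha>1_less by simp
  have i: "integrable lborel (\<lambda>x. c * indicator {-\<alpha>2..-\<alpha>1} x)" for c :: real
    by (intro integrable_mult_right integrable_real_indicator) (auto simp: emeasure_lborel_Icc_eq)
  have "1 = (\<integral>x. pm1 x \<partial>lborel)" using prob_density_onD(4)[OF pm1] by simp
  also have "\<dots> \<le> (\<integral>x. (\<beta> * p1 y) * indicator {-\<alpha>2..-\<alpha>1} x \<partial>lborel)"
  proof (rule integral_mono_AE[OF prob_density_onD(3)[OF pm1] i])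
    show "AE x in lborel. pm1 x \<le> (\<beta> * p1 y) * indicator {-\<alpha>2..-\<alpha>1} x"
      using AE by eventually_elim
        (use density_ratio(3)[OF _ y] prob_density_onD(5)[OF pm1] in \<open>auto simp: indicator_def\<close>)
  qed
  finally have "1 \<le> (\<beta> * p1 y) * (\<alpha>2 - \<alpha>1)" unfolding int .
  then show "1 / (\<beta> * (\<alpha>2 - \<alpha>1)) \<le> p1 y" using d \<beta>_ge by (simp add: field_simps)
  have "p1 y * (\<alpha>2 - \<alpha>1) = (\<integral>x. p1 y * indicator {-\<alpha>2..-\<alpha>1} x \<partial>lborel)" by (rule int[symmetric])
  also have "\<dots> \<le> (\<integral>x. \<beta> * pm1 x \<partial>lborel)"
  proof (rule integral_mono_AE[OF i])
    show "AE x in lborel. p1 y * indicator {-\<alpha>2..-\<alpha>1} x \<le> \<beta> * pm1 x"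
      using AE by eventually_elim
        (use density_ratio(2)[OF _ y] prob_density_onD(5)[OF pm1] in \<open>auto simp: indicator_def\<close>)
  qed (use prob_density_onD(3)[OF pm1] in auto)
  also have "\<dots> = \<beta>" using prob_density_onD(4)[OF pm1] by simp
  finally show "p1 y \<le> \<beta> / (\<alpha>2 - \<alpha>1)" using d by (simp add: field_simps)
qed

text \<open>The lower bound turns closeness of levels into closeness of points and gives strict
  monotonicity; the upper bound gives continuity.\<close>

lemma cdf1_diff_bounds:
  assumes "\<alpha>1 \<le> c" "c \<le> c'" "c' \<le> \<alpha>2"
  shows "(c' - c) / (\<beta> * (\<alpha>2 - \<alpha>1)) \<le> cdf1 c' - cdf1 c" "cdf1 c' - cdf1 c \<le> (c' - c) * (\<beta> / (\<alpha>2 - \<alpha>1))"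
proof -
  have eq: "cdf1 c' - cdf1 c = (\<integral>y. p1 y * indicator {c<..c'} y \<partial>lborel)"
  proof -
    have "(\<lambda>y. p1 y * indicator {c<..c'} y) = (\<lambda>y. p1 y * indicator {..c'} y - p1 y * indicator {..c} y)"
      using assms by (auto simp: fun_eq_iff indicator_def)
    then show ?thesis unfolding cdf1_def by (simp add: cdf1_integrable)
  qed
  have AE: "AE y in lborel. y \<in> {c<..c'} \<longrightarrow> y \<in> {\<alpha>1<..<\<alpha>2}"
    using AE_lborel_singleton[of \<alpha>2] by eventually_elim (use assms in auto)
  have i: "integrable lborel (\<lambda>x. d * indicator {c<..c'} x)" for d :: real
    by (intro integrable_mult_right integrable_real_indicator) (use assms in auto)
  have int: "(\<integral>x. d * indicator {c<..c'} x \<partial>lborel) = d * (c' - c)" for d :: real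
    using assms by simp
  have "(\<integral>x. 1 / (\<beta> * (\<alpha>2 - \<alpha>1)) * indicator {c<..c'} x \<partial>lborel) \<le> (\<integral>y. p1 y * indicator {c<..c'} y \<partial>lborel)"
  proof (rule integral_mono_AE[OF i cdf1_integrable])
    show "AE x in lborel. 1 / (\<beta> * (\<alpha>2 - \<alpha>1)) * indicator {c<..c'} x \<le> p1 x * indicator {c<..c'} x"
      using AE by eventually_elim (use p1_bounds(1) in \<open>auto simp: indicator_def\<close>)
  qed simp
  then show "(c' - c) / (\<beta> * (\<alpha>2 - \<alpha>1)) \<le> cdf1 c' - cdf1 c" unfolding eq int by simp
  have "(\<integral>y. p1 y * indicator {c<..c'} y \<partial>lborel) \<le> (\<integral>x. (\<beta> / (\<alpha>2 - \<alpha>1)) * indicator {c<..c'} x \<partial>lborel)"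
  proof (rule integral_mono_AE[OF cdf1_integrable i])
    show "AE x in lborel. p1 x * indicator {c<..c'} x \<le> (\<beta> / (\<alpha>2 - \<alpha>1)) * indicator {c<..c'} x"
      using AE by eventually_elim (use p1_bounds(2) in \<open>auto simp: indicator_def\<close>)
  qed simp
  then show "cdf1 c' - cdf1 c \<le> (c' - c) * (\<beta> / (\<alpha>2 - \<alpha>1))" unfolding eq int by (simp add: mult.commute)
qed

lemma cdf1_ends: "cdf1 \<alpha>1 = 0" "cdf1 \<alpha>2 = 1"
proof -
  have "cdf1 \<alpha>1 = (\<integral>y. 0 \<partial>(lborel :: real measure))"
    unfolding cdf1_def
  proof (rule integral_cong_AE)
    show "AE y in lborel. p1 y * indicator {..\<alpha>1} y = 0"
      using AE_lborel_singleton[of \<alpha>1]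
      by eventually_elim (use prob_density_onD(5)[OF p1] in \<open>auto simp: indicator_def\<close>)
  qed (use prob_density_onD(1)[OF p1] in auto)
  then show "cdf1 \<alpha>1 = 0" by simp
  have "cdf1 \<alpha>2 = (\<integral>y. p1 y \<partial>lborel)"
    unfolding cdf1_def
    by (rule Bochner_Integration.integral_cong) (use prob_density_onD(5)[OF p1] in \<open>auto simp: indicator_def\<close>)
  then show "cdf1 \<alpha>2 = 1" using prob_density_onD(4)[OF p1] by simp
qed

lemma continuous_on_cdf1: "continuous_on {\<alpha>1..\<alpha>2} cdf1"
proof (rule continuous_on_iff[THEN iffD2], intro ballI allI impI)
  fix x e :: real assume x: "x \<in> {\<alpha>1..\<alpha>2}" and e: "0 < e"
  define K where "K = \<beta> / (\<alpha>2 - \<alpha>1)"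
  have K: "0 < K" using \<beta>_ge \<alpha>1_less by (simp add: K_def)
  have lip: "\<bar>cdf1 y - cdf1 z\<bar> \<le> \<bar>y - z\<bar> * K" if "z \<le> y" "y \<in> {\<alpha>1..\<alpha>2}" "z \<in> {\<alpha>1..\<alpha>2}" for y z
  proof -
    have "0 \<le> (y - z) / (\<beta> * (\<alpha>2 - \<alpha>1))" using that \<beta>_ge \<alpha>1_less by simp
    then show ?thesis using cdf1_diff_bounds[of z y] that by (auto simp: K_def)
  qed
  have lip': "\<bar>cdf1 y - cdf1 x\<bar> \<le> \<bar>y - x\<bar> * K" if "y \<in> {\<alpha>1..\<alpha>2}" for y
    using lip[of x y] lip[of y x] x that by (cases "x \<le> y") (auto simp: abs_minus_commute)
  show "\<exists>d>0. \<forall>y\<in>{\<alpha>1..\<alpha>2}. dist y x < d \<longrightarrow> dist (cdf1 y) (cdf1 x) < e"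
  proof (intro exI[of _ "e / K"] conjI ballI impI)
    fix y assume y: "y \<in> {\<alpha>1..\<alpha>2}" "dist y x < e / K"
    then have "\<bar>y - x\<bar> * K < e" using K by (simp add: dist_real_def field_simps)
    then show "dist (cdf1 y) (cdf1 x) < e" using lip'[OF y(1)] by (simp add: dist_real_def)
  qed (use e K in auto)
qed

text \<open>As the noise vanishes, the standardized argument tends to plus or minus infinity
  according to the side of \<open>c\<close> on which \<open>y\<close> lies; \<open>y = c\<close> is
  a null case, and \<open>p1\<close> dominates.\<close>

lemma quantile_tendsto: "((\<lambda>s. quantile s c) \<longlongrightarrow> cdf1 c) (at_left 1)"
proof (rule tendsto_at_left_sequentially[of 0])
  fix S :: "nat \<Rightarrow> real"
  assume S: "\<And>n. S n < 1" "\<And>n. 0 < S n" and lim: "S \<longlonglongrightarrow> 1"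
  have bpos: "0 < sqrt (1 - (S n)\<^sup>2)" for n
    using one_minus_square_pos[of "S n"] S[of n] by simp
  have "(\<lambda>n. sqrt (1 - (S n)\<^sup>2)) \<longlonglongrightarrow> sqrt (1 - 1\<^sup>2)" by (intro tendsto_intros lim)
  then have b0: "(\<lambda>n. sqrt (1 - (S n)\<^sup>2)) \<longlonglongrightarrow> 0" by simp
  have binf: "filterlim (\<lambda>n. inverse (sqrt (1 - (S n)\<^sup>2))) at_top sequentially"
    using b0 bpos by (intro filterlim_inverse_at_top) auto
  have num: "(\<lambda>n. c - S n * y) \<longlonglongrightarrow> c - 1 * y" for y by (intro tendsto_intros lim)
  note [measurable] = prob_density_onD(1)[OF p1]
  show "(\<lambda>n. quantile (S n) c) \<longlonglongrightarrow> cdf1 c"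
    unfolding quantile_def cdf1_def
  proof (rule integral_dominated_convergence[where w = p1])
    show "AE y in lborel. (\<lambda>n. p1 y * std_normal_cdf (std_arg (S n) c y)) \<longlonglongrightarrow> p1 y * indicator {..c} y"
      using AE_lborel_singleton[of c]
    proof eventually_elim
      case (elim y)
      have "(\<lambda>n. std_normal_cdf (std_arg (S n) c y)) \<longlonglongrightarrow> indicator {..c} y"
      proof (cases "y < c")
        case True
        have "filterlim (\<lambda>n. (c - S n * y) * inverse (sqrt (1 - (S n)\<^sup>2))) at_top sequentially"
          by (rule filterlim_tendsto_pos_mult_at_top[OF num _ binf]) (use True in simp)
        then have "filterlim (\<lambda>n. std_arg (S n) c y) at_top sequentially"
          by (simp add: std_arg_def divide_inverse)
        from filterlim_compose[OF std_normal.cdf_lim_at_top_prob this] True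
        show ?thesis by simp
      next
        case False
        then have "c < y" using elim by simp
        have "filterlim (\<lambda>n. (c - S n * y) * inverse (sqrt (1 - (S n)\<^sup>2))) at_bot sequentially"
          by (rule filterlim_tendsto_neg_mult_at_bot[OF num _ binf]) (use \<open>c < y\<close> in simp)
        then have "filterlim (\<lambda>n. std_arg (S n) c y) at_bot sequentially"
          by (simp add: std_arg_def divide_inverse)
        from filterlim_compose[OF std_normal.cdf_lim_at_bot this] \<open>c < y\<close>
        show ?thesis by simp
      qed
      then show ?case by (intro tendsto_intros)
    qed
    show "AE y in lborel. norm (p1 y * std_normal_cdf (std_arg (S n) c y)) \<le> p1 y" for n
    proof (rule AE_I2)
      fix y
      have "p1 y * std_normal_cdf (std_arg (S n) c y) \<le> p1 y * 1"
        using prob_density_onD(2)[OF p1] std_normal.cdf_bounded_prob by (intro mult_left_mono) auto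
      then show "norm (p1 y * std_normal_cdf (std_arg (S n) c y)) \<le> p1 y"
        using prob_density_onD(2)[OF p1, of y] std_normal.cdf_nonneg[of "std_arg (S n) c y"] by (simp add: abs_mult)
    qed
  qed (use prob_density_onD(3)[OF p1] in auto)
qed simp

text \<open>The level never falls below its initial value \<open>f\<close>, while at a fixed
  \<open>c\<close> it tends to f / 2. So the trajectory finally stays above \<open>c > 0\<close>,
  where the rate is at most \<open>C\<close> times 1 - F, and Gronwall keeps 1 - F away from
  zero.\<close>

lemma flow_quantile_bounded_below_1:
  assumes s0: "0 < s0" "s0 < 1" and y: "flow s0 y"
  shows "\<exists>\<delta>>0. \<forall>s\<in>{s0..<1}. quantile s (y s) \<le> 1 - \<delta>"
proof -
  let ?F = "\<lambda>s. quantile s (y s)"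
  define f where "f = ?F s0"
  have f: "0 < f" "f < 1" unfolding f_def by (rule quantile_pos quantile_less_1)+
  have "\<exists>c. \<alpha>1 \<le> c \<and> c \<le> \<alpha>2 \<and> cdf1 c = f / 2"
    using IVT'[of cdf1 \<alpha>1 "f / 2" \<alpha>2] f cdf1_ends continuous_on_cdf1 \<alpha>1_less by auto
  then obtain c where c: "\<alpha>1 \<le> c" "cdf1 c = f / 2" by blast
  have "eventually (\<lambda>s. quantile s c < f) (at_left 1)"
    using order_tendstoD(2)[OF quantile_tendsto[of c], of f] c f by simp
  then obtain r where r: "r < 1" "\<And>s. r < s \<Longrightarrow> s < 1 \<Longrightarrow> quantile s c < f"
    unfolding eventually_at_left_field by auto
  \<comment> \<open>Late enough for the comparison with \<open>c\<close>, for the rate bound, which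
    asks for s \<ge> 1/2, and for the trajectory to be defined.\<close>
  define s1 where "s1 = max (max ((r + 1) / 2) (1/2)) s0"
  have s1: "r < s1" "1/2 \<le> s1" "s0 \<le> s1" "s1 < 1" using r s0 by (auto simp: s1_def less_max_iff_disj)
  have yc: "c \<le> y s" if "s1 \<le> s" "s < 1" for s
  proof (rule ccontr)
    assume "\<not> c \<le> y s"
    then have "?F s \<le> quantile s c" using that s1 s0 by (intro quantile_mono) auto
    also have "\<dots> < f" using r(2)[of s] that s1 by simp
    also have "f \<le> ?F s" unfolding f_def by (rule quantile_flow_mono[OF s0(1) y]) (use that s1 in auto)
    finally show False by simp
  qed
  obtain C where C: "0 \<le> C" "\<And>s x. 1/2 \<le> s \<Longrightarrow> s < 1 \<Longrightarrow> c \<le> x \<Longrightarrow>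
      quantile_density s x * guidance s x / (sqrt (1 - s\<^sup>2)) ^ 3 \<le> C * (1 - quantile s x)"
    using quantile_flow_rate_le[of c] c \<alpha>1_pos by auto
  have low: "(1 - ?F s1) * exp (- C) \<le> 1 - ?F s" if s: "s1 \<le> s" "s < 1" for s
  proof -
    \<comment> \<open>The integrating factor turns F' \<le> C (1 - F) into monotonicity; as the
      remaining time is at most 1, the loss is at most exp (- C).\<close>
    let ?h = "\<lambda>t. (1 - ?F t) * exp (C * t)"
    have "?h s1 \<le> ?h s"
    proof (rule DERIV_nonneg_imp_increasing_open[OF s(1)])
      fix t assume t: "s1 < t" "t < s"
      let ?d = "quantile_density t (y t) * guidance t (y t) / (sqrt (1 - t\<^sup>2)) ^ 3"
      have "(?F has_real_derivative ?d) (at t within {s0<..<1})"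
        by (rule DERIV_subset[OF quantile_flow_has_derivative[OF s0(1) y]]) (use t s s1 in auto)
      then have D: "(?F has_real_derivative ?d) (at t)"
        using at_within_open[of t "{s0<..<1}"] t s s1 by simp
      have "(?h has_real_derivative (C * (1 - ?F t) - ?d) * exp (C * t)) (at t)"
        by (auto intro!: derivative_eq_intros D simp: algebra_simps)
      moreover have "?d \<le> C * (1 - ?F t)"
        by (rule C(2)) (use t s s1 yc in auto)
      ultimately show "\<exists>d. (?h has_real_derivative d) (at t) \<and> 0 \<le> d"
        by (intro exI conjI) auto
    next
      have "continuous_on {s0..<1} ?F"
        by (rule DERIV_continuous_on) (rule quantile_flow_has_derivative[OF s0(1) y])
      then have "continuous_on {s1..s} ?F"
        by (rule continuous_on_subset) (use s s1 in auto)
      then show "continuous_on {s1..s} ?h" by (intro continuous_intros)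
    qed
    then have "(1 - ?F s1) * exp (C * s1) * exp (- C * s) \<le> 1 - ?F s"
      by (simp add: exp_minus field_simps)
    moreover have "(1 - ?F s1) * exp (- C) \<le> (1 - ?F s1) * exp (C * s1 - C * s)"
    proof (intro mult_left_mono)
      have "C * (s - s1) \<le> C * 1" using C(1) s s1 s0 by (intro mult_left_mono) auto
      then show "exp (- C) \<le> exp (C * s1 - C * s)" by (simp add: algebra_simps)
    qed (use quantile_less_1[of s1 "y s1"] in simp)
    moreover have "exp (C * s1 - C * s) = exp (C * s1) * exp (- C * s)" by (simp add: exp_add[symmetric])
    ultimately show ?thesis by (simp only: mult.assoc)
  qed
  define \<delta> where "\<delta> = (1 - ?F s1) * exp (- C)"
  have "0 < \<delta>" using quantile_less_1[of s1 "y s1"] by (simp add: \<delta>_def)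
  moreover have "?F s \<le> 1 - \<delta>" if s: "s \<in> {s0..<1}" for s
  proof (cases "s1 \<le> s")
    case True
    then show ?thesis using low[of s] s by (simp add: \<delta>_def)
  next
    case False
    then have "?F s \<le> ?F s1" using s s1 by (intro quantile_flow_mono[OF s0(1) y]) auto
    then show ?thesis using low[of s1] s1 by (simp add: \<delta>_def)
  qed
  ultimately show ?thesis by blast
qed

text \<open>The level increases to a supremum \<open>f\<close> strictly between 0 and 1, and
  \<open>L\<close> is the point with \<open>cdf1 L = f\<close>. Comparing with
  \<open>quantile s c\<close> at points \<open>c\<close> just off \<open>L\<close> traps the
  trajectory, since \<open>quantile\<close> is monotone in its second argument.\<close>

lemma flow_limit:
  assumes s0: "0 < s0" "s0 < 1" and y: "flow s0 y"
  shows "\<exists>L. (y \<longlongrightarrow> L) (at_left 1) \<and> \<alpha>1 < L \<and> L < \<alpha>2 \<and> (\<forall>s\<in>{s0..<1}. quantile s (y s) \<le> cdf1 L)"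
proof -
  let ?F = "\<lambda>s. quantile s (y s)"
  obtain \<delta> where \<delta>: "0 < \<delta>" "\<And>s. s \<in> {s0..<1} \<Longrightarrow> ?F s \<le> 1 - \<delta>"
    using flow_quantile_bounded_below_1[OF s0 y] by blast
  define f where "f = Sup (?F ` {s0..<1})"
  have bdd: "bdd_above (?F ` {s0..<1})" using \<delta>(2) by (rule bdd_aboveI2)
  have up: "?F s \<le> f" if "s \<in> {s0..<1}" for s
    unfolding f_def using bdd that by (intro cSup_upper) auto
  have f1: "f \<le> 1 - \<delta>" unfolding f_def using \<delta>(2) s0 by (intro cSup_least) auto
  have f0: "0 < f" using up[of s0] quantile_pos[of s0 "y s0"] s0 by simp
  obtain L where L: "\<alpha>1 \<le> L" "L \<le> \<alpha>2" "cdf1 L = f"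
    using IVT'[of cdf1 \<alpha>1 f \<alpha>2] f0 f1 \<delta> cdf1_ends continuous_on_cdf1 \<alpha>1_less by auto
  have L': "\<alpha>1 < L" "L < \<alpha>2" using L f0 f1 \<delta> cdf1_ends by (auto simp: less_le)
  have strict: "cdf1 c < cdf1 c'" if "\<alpha>1 \<le> c" "c < c'" "c' \<le> \<alpha>2" for c c'
  proof -
    have "0 < (c' - c) / (\<beta> * (\<alpha>2 - \<alpha>1))" using that \<beta>_ge \<alpha>1_less by simp
    then show ?thesis using cdf1_diff_bounds(1)[of c c'] that by simp
  qed
  have ev: "eventually (\<lambda>s. s \<in> {s0..<1}) (at_left 1)"
    unfolding eventually_at_left_field using s0 by (auto intro!: exI[of _ s0])
  have "(y \<longlongrightarrow> L) (at_left 1)"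
  proof (rule order_tendstoI)
    fix a assume a: "a < L"
    \<comment> \<open>The maximum keeps \<open>c\<close> inside the support, where
      \<open>cdf1\<close> is strictly increasing.\<close>
    define c where "c = (max a \<alpha>1 + L) / 2"
    have c: "a < c" "\<alpha>1 \<le> c" "c < L" using a L' by (auto simp: c_def)
    have "cdf1 c < f" using strict[of c L] c L by simp
    \<comment> \<open>A level between the two: the flow passes it for good, while
      \<open>quantile s c\<close> ends up below it.\<close>
    define m where "m = (cdf1 c + f) / 2"
    have m: "cdf1 c < m" "m < f" using \<open>cdf1 c < f\<close> by (auto simp: m_def)
    obtain s1 where s1: "s1 \<in> {s0..<1}" "m < ?F s1"
      using less_cSupD[of "?F ` {s0..<1}" m] m s0 unfolding f_def by auto
    have ev1: "eventually (\<lambda>s. quantile s c < m) (at_left 1)"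
      using order_tendstoD(2)[OF quantile_tendsto[of c]] m by blast
    have ev2: "eventually (\<lambda>s. s \<in> {s1..<1}) (at_left 1)"
      unfolding eventually_at_left_field using s1 by (auto intro!: exI[of _ s1])
    show "eventually (\<lambda>s. a < y s) (at_left 1)"
      using ev1 ev2
    proof eventually_elim
      case (elim s)
      show ?case
      proof (rule ccontr)
        assume "\<not> a < y s"
        then have "?F s \<le> quantile s c" using c elim s1 s0 by (intro quantile_mono) auto
        moreover have "?F s1 \<le> ?F s" by (rule quantile_flow_mono[OF s0(1) y]) (use elim s1 in auto)
        ultimately show False using elim s1 by simp
      qed
    qed
  next
    fix a assume a: "L < a"
    define c where "c = (min a \<alpha>2 + L) / 2"
    have c: "c < a" "c \<le> \<alpha>2" "L < c" using a L' by (auto simp: c_def)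
    have "f < cdf1 c" using strict[of L c] c L by simp
    have ev1: "eventually (\<lambda>s. f < quantile s c) (at_left 1)"
      using order_tendstoD(1)[OF quantile_tendsto[of c]] \<open>f < cdf1 c\<close> by blast
    show "eventually (\<lambda>s. y s < a) (at_left 1)"
      using ev1 ev
    proof eventually_elim
      case (elim s)
      show ?case
      proof (rule ccontr)
        assume "\<not> y s < a"
        then have "quantile s c \<le> ?F s" using c elim s0 by (intro quantile_mono) auto
        then show False using elim up[of s] by simp
      qed
    qed
  qed
  then show ?thesis using L' L up by auto
qed

subsection \<open>Overshooting for large guidance\<close>

text \<open>While \<open>y \<le> 2 sqrt (ln w)\<close> and \<open>s \<le> 1/2\<close>, the guidance is at least \<open>A = (w powr (3/4)) \<alpha>1 / \<beta>\<close>, and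
  \<open>A / 8\<close> exceeds the distance to be covered.\<close>
lemma flow_overshoot:
  assumes s0: "0 < s0" "s0 \<le> 1/4" and y: "flow s0 y" and big: "1024 < ln w" and a2: "32 * \<alpha>2 \<le> sqrt (ln w)"
    and w1: "ln w / (16 * sqrt w) \<le> \<alpha>1 * \<alpha>2 / \<beta>"
    and start: "- (sqrt w * \<alpha>1 / (16 * \<beta>)) \<le> y s0"
  shows "\<exists>s\<in>{s0..1/2}. 2 * sqrt (ln w) \<le> y s"
proof (rule ccontr)
  assume "\<not> ?thesis"
  then have less: "\<And>s. s \<in> {s0..1/2} \<Longrightarrow> y s < 2 * sqrt (ln w)" by (auto simp: not_le)
  define l where "l = sqrt (ln w)"
  \<comment> \<open>The fourth root of \<open>w\<close>, so that all powers of \<open>w\<close> in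
    use are integer powers of \<open>h\<close>.\<close>
  define h where "h = exp (ln w / 4)"
  define A where "A = h ^ 3 * \<alpha>1 / \<beta>"
  have l: "0 < l" "l\<^sup>2 = ln w" using big by (auto simp: l_def)
  have a2pos: "0 < \<alpha>2" using \<alpha>1_pos \<alpha>1_less by simp
  have h: "257 \<le> h" using exp_ge_add_one_self[of "ln w / 4"] big unfolding h_def by linarith
  have "h ^ 4 = exp (4 * (ln w / 4))" unfolding h_def exp_of_nat_mult[symmetric] by simp
  then have hw: "h ^ 4 = w" using w_pos by simp
  have hs: "sqrt w = h\<^sup>2"
    using h hw by (intro real_sqrt_unique) (auto simp: power_mult[symmetric])
  \<comment> \<open>Bounding one factor \<alpha>2 by l / 32 reproduces the left side of
    \<open>w1\<close>; then \<alpha>2 cancels.\<close>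
  have "2 * l / h\<^sup>2 \<le> \<alpha>1 / \<beta>"
  proof -
    have "2 * l / h\<^sup>2 * \<alpha>2 \<le> 2 * l / h\<^sup>2 * (l / 32)"
      using a2 l h by (intro mult_left_mono) (auto simp: l_def)
    also have "\<dots> = ln w / (16 * sqrt w)" unfolding hs l(2)[symmetric] by (simp add: power2_eq_square)
    also have "\<dots> \<le> \<alpha>1 / \<beta> * \<alpha>2" using w1 by simp
    finally show ?thesis using a2pos by (rule mult_right_le_imp_le)
  qed
  then have "h ^ 3 * (2 * l / h\<^sup>2) \<le> h ^ 3 * (\<alpha>1 / \<beta>)" using h by (intro mult_left_mono) auto
  then have Ah: "2 * l * h \<le> A" using h by (simp add: A_def power2_eq_square power3_eq_cube mult.commute[of h "2 * l"])
  have "2 * l * 257 \<le> 2 * l * h" using h l by (intro mult_left_mono) auto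
  then have Al: "514 * l \<le> A" using Ah by linarith
  have v: "A / 2 \<le> vel s (y s)" if s: "s \<in> {s0..1/2}" for s
  proof -
    define B where "B = 1 - s\<^sup>2"
    have s1: "0 < s" "s \<le> 1/2" using s s0 by auto
    have "s\<^sup>2 \<le> (1/2)\<^sup>2" using s1 by (intro power_mono) auto
    then have B: "3/4 \<le> B" "B \<le> 1" by (auto simp: B_def power2_eq_square)
    have sy: "s * y s \<le> l"
    proof (cases "0 \<le> y s")
      case True
      have "s * y s \<le> 1/2 * (2 * l)" using True s1 less[OF s] by (intro mult_mono) (auto simp: l_def)
      then show ?thesis by simp
    next
      case False
      then have "s * y s \<le> 0" using s1 by (simp add: mult_le_0_iff)
      then show ?thesis using l by simp
    qed
    have "s * y s / B \<le> l / B" using sy B by (intro divide_right_mono) auto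
    also have "l / B \<le> l / (3/4)" using B l by (intro divide_left_mono) auto
    finally have m: "max (s * y s / B) 0 \<le> 4 / 3 * l" using l by simp
    \<comment> \<open>The exponent comes to l^2 / 12, within the \<open>ln w / 4\<close> that
      defines \<open>h\<close>.\<close>
    have "2 * max (s * y s / B) 0 * \<alpha>2 \<le> 2 * (4 / 3 * l) * (l / 32)"
      using m a2 a2pos l by (intro mult_mono) (auto simp: l_def)
    also have "\<dots> \<le> ln w / 4" unfolding l(2)[symmetric] by (simp add: power2_eq_square)
    finally have e: "exp (2 * max (s * y s / B) 0 * \<alpha>2) \<le> h" by (simp add: h_def)
    have "A = w * \<alpha>1 / (\<beta> * h)"
      unfolding A_def hw[symmetric] using h \<beta>_ge by (simp add: field_simps power3_eq_cube eval_nat_numeral)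
    also have "\<dots> \<le> w * \<alpha>1 / (\<beta> * exp (2 * max (s * y s / B) 0 * \<alpha>2))"
      using e \<beta>_ge w_pos \<alpha>1_pos h by (intro divide_left_mono mult_left_mono mult_pos_pos) auto
    also have "\<dots> \<le> guidance s (y s)" unfolding B_def by (rule guidance_ge)
    finally have g: "A \<le> guidance s (y s)" .
    have "0 \<le> mean1 s (y s)"
      unfolding mean1_def using tilt_mean_bounds(1)[OF p1] \<alpha>1_pos by (meson less_imp_le order.trans)
    then have n: "A / 2 \<le> mean1 s (y s) + guidance s (y s) - s * y s"
      using g sy Al l by linarith
    have "A / 2 = A / 2 / 1" by simp
    also have "\<dots> \<le> (mean1 s (y s) + guidance s (y s) - s * y s) / B"
      using n B Al l by (intro frac_le) auto
    finally show ?thesis unfolding vel_def B_def .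
  qed
  \<comment> \<open>Speed at least A / 2 over a time of at least 1/4 gains A / 8; the start lies at
    most A / 16 below zero, so \<open>y (1/2)\<close> is at least A / 16, which exceeds 2 l because
    A \<ge> 514 l.\<close>
  have "y s0 - A / 2 * s0 \<le> y (1/2) - A / 2 * (1/2)"
  proof (rule DERIV_nonneg_imp_increasing_open[of s0 "1/2" "\<lambda>s. y s - A / 2 * s"])
    fix t assume t: "s0 < t" "t < 1/2"
    have "(y has_real_derivative vel t (y t)) (at t within {s0<..<1})"
      by (rule DERIV_subset[of _ _ _ "{s0..<1}"]) (use y t in \<open>auto simp: flow_def\<close>)
    then have D: "(y has_real_derivative vel t (y t)) (at t)"
      using at_within_open[of t "{s0<..<1}"] t by simp
    have "((\<lambda>s. y s - A / 2 * s) has_real_derivative vel t (y t) - A / 2) (at t)"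
      by (auto intro!: derivative_eq_intros D)
    then show "\<exists>d. ((\<lambda>s. y s - A / 2 * s) has_real_derivative d) (at t) \<and> 0 \<le> d"
      using v[of t] t by (intro exI[of _ "vel t (y t) - A / 2"] conjI) auto
  next
    have "continuous_on {s0..1/2} y"
      by (rule continuous_on_subset[OF flow_continuous_on[OF y]]) auto
    then show "continuous_on {s0..1/2} (\<lambda>s. y s - A / 2 * s)" by (intro continuous_intros)
  qed (use s0 in simp)
  moreover have "A / 2 * s0 \<le> A / 2 * (1/4)" using s0 Al l by (intro mult_left_mono) auto
  moreover have "sqrt w * \<alpha>1 / (16 * \<beta>) \<le> A / 16"
  proof -
    have "h\<^sup>2 * (\<alpha>1 / \<beta>) \<le> h ^ 3 * (\<alpha>1 / \<beta>)"
      using h \<alpha>1_pos \<beta>_ge by (intro mult_right_mono power_increasing) auto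
    from divide_right_mono[OF this, of 16] show ?thesis unfolding hs A_def by (simp add: mult.commute)
  qed
  ultimately have "A / 16 \<le> y (1/2)" using start by linarith
  moreover have "y (1/2) < 2 * l" using less[of "1/2"] s0 by (simp add: l_def)
  ultimately show False using Al l by linarith
qed

text \<open>As s y \<le> \<alpha>2 / 2 is small against \<open>l\<close>, the standardized argument
  is at least 3 l / 2, and the Gaussian tail exp (- 9 l^2 / 8) there is at most exp (- l^2) = 1 /
  w.\<close>

lemma quantile_tail:
  assumes s: "0 < s" "s \<le> 1/2" and a2: "32 * \<alpha>2 \<le> sqrt (ln w)" and x: "2 * sqrt (ln w) \<le> x" and w: "1 < w"
  shows "1 - quantile s x \<le> 1 / w"
proof -
  define l where "l = sqrt (ln w)"
  have l: "0 < l" "l\<^sup>2 = ln w" using w by (auto simp: l_def)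
  have i: "integrable lborel (\<lambda>y. p1 y * (1 - std_normal_cdf (std_arg s x y)))"
    using quantile_integrable[of s x] prob_density_onD(3)[OF p1] by (simp add: right_diff_distrib)
  have "1 - quantile s x \<le> (\<integral>y. p1 y * (1 / w) \<partial>lborel)"
    unfolding quantile_compl
  proof (rule prob_density_on_integral_mono[OF p1 i])
    show "integrable lborel (\<lambda>y. p1 y * (1 / w))" using prob_density_onD(3)[OF p1] by simp
    fix y assume y: "y \<in> {\<alpha>1..\<alpha>2}"
    have B: "0 < 1 - s\<^sup>2" "sqrt (1 - s\<^sup>2) \<le> 1" using one_minus_square_pos[of s] s by auto
    have "s * y \<le> 1/2 * \<alpha>2" using s y \<alpha>1_pos by (intro mult_mono) auto
    then have n: "3/2 * l \<le> x - s * y"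
      using x a2 l unfolding l_def[symmetric] by linarith
    have "3/2 * l / 1 \<le> std_arg s x y"
      unfolding std_arg_def using n B l by (intro frac_le) auto
    then have "std_normal_cdf (3/2 * l) \<le> std_normal_cdf (std_arg s x y)"
      by (intro std_normal.cdf_nondecreasing) simp
    moreover have "1 - std_normal_cdf (3/2 * l) \<le> exp (- (3/2 * l)\<^sup>2 / 2)"
      using l by (intro std_normal_cdf_tail) simp
    moreover have "exp (- (3/2 * l)\<^sup>2 / 2) \<le> exp (- ln w)"
      unfolding l(2)[symmetric] by (simp add: power_mult_distrib power_divide)
    moreover have "exp (- ln w) = 1 / w" using w by (simp add: exp_minus inverse_eq_divide)
    ultimately show "1 - std_normal_cdf (std_arg s x y) \<le> 1 / w" by linarith
  qed
  also have "\<dots> = 1 / w" using prob_density_onD(4)[OF p1] by simp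
  finally show ?thesis .
qed

text \<open>Overshooting leaves a missing level of at most 1 / w, which monotonicity carries to the
  limit; the lower bound on \<open>p1\<close> converts it into a distance to \<alpha>2.\<close>

lemma flow_limit_lower:
  assumes s0: "0 < s0" "s0 \<le> 1/4" and y: "flow s0 y" and big: "1024 < ln w" and a2: "32 * \<alpha>2 \<le> sqrt (ln w)"
    and w1: "ln w / (16 * sqrt w) \<le> \<alpha>1 * \<alpha>2 / \<beta>"
    and start: "- (sqrt w * \<alpha>1 / (16 * \<beta>)) \<le> y s0"
    and L: "\<alpha>1 < L" "L < \<alpha>2" "\<forall>s\<in>{s0..<1}. quantile s (y s) \<le> cdf1 L"
  shows "\<alpha>2 * (1 - 32 / sqrt (ln w)) < L"
proof -
  have a2pos: "0 < \<alpha>2" using \<alpha>1_pos \<alpha>1_less by simp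
  have w: "1 < w" using big w_pos by (metis ln_gt_zero_iff less_trans zero_less_numeral)
  have lw: "0 < ln w" using big by simp
  obtain s where s: "s \<in> {s0..1/2}" "2 * sqrt (ln w) \<le> y s"
    using flow_overshoot[OF s0 y big a2 w1 start] by blast
  have "1 - quantile s (y s) \<le> 1 / w" by (rule quantile_tail) (use s s0 a2 w in auto)
  moreover have "quantile s (y s) \<le> cdf1 L" using L(3) s by auto
  moreover have "(\<alpha>2 - L) / (\<beta> * (\<alpha>2 - \<alpha>1)) \<le> 1 - cdf1 L"
    using cdf1_diff_bounds(1)[of L \<alpha>2] L cdf1_ends by simp
  ultimately have "(\<alpha>2 - L) / (\<beta> * (\<alpha>2 - \<alpha>1)) \<le> 1 / w" by linarith
  then have "\<alpha>2 - L \<le> 1 / w * (\<beta> * (\<alpha>2 - \<alpha>1))"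
    using \<beta>_ge \<alpha>1_less by (simp add: pos_divide_le_eq)
  also have "\<dots> \<le> 1 / w * (sqrt w * \<alpha>2)"
  proof (intro mult_left_mono mult_mono)
    \<comment> \<open>The bound on \<alpha>2 gives 16 \<alpha>1 \<alpha>2 \<le> ln w, and then
      \<open>w1\<close> yields \<beta> \<le> sqrt w.\<close>
    have "(32 * \<alpha>2)\<^sup>2 \<le> (sqrt (ln w))\<^sup>2" using a2 a2pos by (intro power_mono) auto
    then have "1024 * \<alpha>2\<^sup>2 \<le> ln w" using lw by (simp add: power_mult_distrib)
    moreover have "\<alpha>1 * \<alpha>2 \<le> \<alpha>2 * \<alpha>2" using \<alpha>1_less a2pos by (intro mult_right_mono) auto
    ultimately have aa: "16 * (\<alpha>1 * \<alpha>2) \<le> ln w"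
      using zero_le_square[of \<alpha>2] unfolding power2_eq_square by linarith
    have "\<beta> * ln w \<le> 16 * (\<alpha>1 * \<alpha>2) * sqrt w"
      using w1 w \<beta>_ge by (simp add: field_simps)
    also have "\<dots> \<le> ln w * sqrt w" using aa w by (intro mult_right_mono) auto
    finally show "\<beta> \<le> sqrt w" using lw by (simp add: mult.commute)
  qed (use w \<alpha>1_pos \<alpha>1_less in auto)
  also have "\<dots> = \<alpha>2 / sqrt w" using w by (simp add: field_simps real_sqrt_mult[symmetric])
  also have "\<dots> \<le> \<alpha>2 / sqrt (ln w)"
    using lw w a2pos ln_less_self[of w] by (intro divide_left_mono) (auto simp: less_imp_le)
  also have "\<dots> < \<alpha>2 * (32 / sqrt (ln w))" using lw a2pos by (simp add: field_simps)
  finally show ?thesis by (simp add: algebra_simps)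
qed

text \<open>The limit is carried back to time \<open>t\<close> by \<open>exp (t - T)\<close>, which
  approaches 1 from the left. The trajectory in s is returned as well, for comparison of
  solutions.\<close>

lemma guided_flow_limit:
  assumes T: "0 < T" and x: "guided_flow_solution p1 pm1 T w x0 x"
  obtains L y where "flow (exp (- T)) y" "y (exp (- T)) = x0" "(x \<longlongrightarrow> L) (at_left T)" "\<alpha>1 < L" "L < \<alpha>2"
    "\<And>t. x t = y (exp (t - T))" "\<forall>s\<in>{exp (- T)..<1}. quantile s (y s) \<le> cdf1 L"
proof -
  define y where "y s = x (T + ln s)" for s
  have f: "flow (exp (- T)) y" unfolding y_def by (rule guided_imp_flow[OF T x])
  have y0: "y (exp (- T)) = x0" using x by (simp add: y_def guided_flow_solution_def)
  have xy: "x t = y (exp (t - T))" for t by (simp add: y_def)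
  obtain L where L: "(y \<longlongrightarrow> L) (at_left 1)" "\<alpha>1 < L" "L < \<alpha>2" "\<forall>s\<in>{exp (- T)..<1}. quantile s (y s) \<le> cdf1 L"
    using flow_limit[OF _ _ f] T by auto
  have "((\<lambda>t. exp (t - T)) \<longlongrightarrow> exp (T - T)) (at_left T)" by (intro tendsto_intros)
  then have "filterlim (\<lambda>t. exp (t - T)) (at_left 1) (at_left T)"
    by (auto simp: filterlim_at eventually_at_filter)
  from filterlim_compose[OF L(1) this] have "(x \<longlongrightarrow> L) (at_left T)" unfolding xy[symmetric] .
  then show ?thesis using that f y0 xy L by blast
qed

end

section \<open>Probability of the good initial values\<close>

theorem theorem3p1:
  fixes p1 pm1 :: "real \<Rightarrow> real" and \<alpha>1 \<alpha>2 \<beta> T w :: real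
  assumes "0 < \<alpha>1" and "\<alpha>1 < \<alpha>2" and "\<beta> \<ge> 1"
    and "prob_density_on p1 \<alpha>1 \<alpha>2"
    and "prob_density_on pm1 (-\<alpha>2) (-\<alpha>1)"
    and "\<And>x1 x2. x1 \<in> {-\<alpha>2<..<-\<alpha>1} \<Longrightarrow> x2 \<in> {\<alpha>1<..<\<alpha>2} \<Longrightarrow>
           1/\<beta> \<le> pm1 x1 / p1 x2 \<and> pm1 x1 / p1 x2 \<le> \<beta>"
    and "T \<ge> 2 * ln 2"
    and "w > exp 1"
    and "ln w / (16 * sqrt w) \<le> \<alpha>1 * \<alpha>2 / \<beta>"
    and "ln w / ln (ln w) \<ge> 1024 * (\<alpha>2 / min \<alpha>1 1)\<^sup>2"
  shows "measure (density lborel std_normal_density)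
           {x0. (\<exists>x. guided_flow_solution p1 pm1 T w x0 x) \<and>
                (\<forall>x. guided_flow_solution p1 pm1 T w x0 x \<longrightarrow>
                   (\<exists>L. (x \<longlongrightarrow> L) (at_left T) \<and>
                        \<alpha>2 * (1 - 32 / sqrt (ln w)) < L \<and> L < \<alpha>2))}
         \<ge> 1 - exp (- (w * \<alpha>1\<^sup>2 / (512 * \<beta>\<^sup>2)))"
proof -
  have w0: "0 < w" using assms(8) exp_gt_zero[of 1] by (simp del: exp_gt_zero)
  interpret guided_mixture p1 pm1 \<alpha>1 \<alpha>2 \<beta> w
    using assms(1-6) w0 by unfold_locales auto
  define lo where "lo = \<alpha>2 * (1 - 32 / sqrt (ln w))"
  define S where "S = {x0. (\<exists>x. guided_flow_solution p1 pm1 T w x0 x) \<and>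
                (\<forall>x. guided_flow_solution p1 pm1 T w x0 x \<longrightarrow>
                   (\<exists>L. (x \<longlongrightarrow> L) (at_left T) \<and> lo < L \<and> L < \<alpha>2))}"
  \<comment> \<open>The admissible start of \<open>flow_overshoot\<close>; r^2 / 2 is the exponent
    of the claimed probability.\<close>
  define r where "r = sqrt w * \<alpha>1 / (16 * \<beta>)"
  have ln2: "0 < ln (2::real)" by simp
  then have T: "0 < T" using assms(7) by linarith
  define s0 where "s0 = exp (- T)"
  \<comment> \<open>The lower bound on \<open>T\<close> leaves time at least 1/4 before s =
    1/2.\<close>
  have "s0 \<le> exp (- (2 * ln 2))" unfolding s0_def using assms(7) by simp
  also have "exp (- (2 * ln 2)) = 1 / (exp (ln 2) * exp (ln (2::real)))"
    unfolding exp_add[symmetric] exp_minus by (simp add: inverse_eq_divide)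
  finally have s0: "0 < s0" "s0 \<le> 1/4" by (auto simp: s0_def)
  have lw: "1 < ln w" using assms(8) w0 by (metis exp_less_cancel_iff exp_ln)
  have ex: "\<exists>x. guided_flow_solution p1 pm1 T w x0 x" for x0
  proof -
    obtain y where "y s0 = x0" "flow s0 y" using flow_exists[of s0 x0] s0 by auto
    then show ?thesis using flow_imp_guided[OF T, of y] unfolding s0_def by blast
  qed
  \<comment> \<open>Order of trajectories passes to their limits, and L < \<alpha>2 holds for every
    solution, so \<open>S\<close> is upward closed. This gives measurability, without which
    \<open>measure\<close> would be 0 by default.\<close>
  have up: "y0 \<in> S" if x0: "x0 \<in> S" and le: "x0 \<le> y0" for x0 y0
  proof -
    obtain u where u: "guided_flow_solution p1 pm1 T w x0 u" using ex by blast
    obtain Lu where Lu: "(u \<longlongrightarrow> Lu) (at_left T)" "lo < Lu" using x0 u unfolding S_def by blast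
    obtain yu where yu: "flow s0 yu" "yu s0 = x0" "\<And>t. u t = yu (exp (t - T))"
      using guided_flow_limit[OF T u] unfolding s0_def by metis
    have "\<exists>L. (v \<longlongrightarrow> L) (at_left T) \<and> lo < L \<and> L < \<alpha>2" if v: "guided_flow_solution p1 pm1 T w y0 v" for v
    proof -
      obtain Lv yv where yv: "flow s0 yv" "yv s0 = y0" "\<And>t. v t = yv (exp (t - T))"
        and Lv: "(v \<longlongrightarrow> Lv) (at_left T)" "Lv < \<alpha>2"
        using guided_flow_limit[OF T v] unfolding s0_def by metis
      have "eventually (\<lambda>t. t \<in> {0..<T}) (at_left T)"
        unfolding eventually_at_left_field using T by (auto intro!: exI[of _ 0])
      then have "eventually (\<lambda>t. u t \<le> v t) (at_left T)"
      proof eventually_elim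
        case (elim t)
        have "yu s0 \<le> yv s0" using yu(2) yv(2) le by simp
        moreover have "exp (t - T) \<in> {s0..<1}" using elim by (simp add: s0_def)
        ultimately show ?case unfolding yu(3) yv(3) by (rule flow_mono[OF s0(1) yu(1) yv(1)])
      qed
      then have "Lu \<le> Lv" by (rule tendsto_le[OF _ Lv(1) Lu(1), rotated]) simp
      then show ?thesis using Lv Lu by auto
    qed
    then show ?thesis using ex unfolding S_def by blast
  qed
  have "is_interval S" unfolding is_interval_1 using up by blast
  then have Sm: "S \<in> sets borel" by (rule real_interval_borel_measurable)
  have sub: "{- r..} \<subseteq> S"
  proof
    fix x0 assume x0: "x0 \<in> {- r..}"
    have "\<exists>L. (x \<longlongrightarrow> L) (at_left T) \<and> lo < L \<and> L < \<alpha>2" if x: "guided_flow_solution p1 pm1 T w x0 x" for x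
    proof -
      obtain L y where y: "flow s0 y" "y s0 = x0" and L: "(x \<longlongrightarrow> L) (at_left T)" "\<alpha>1 < L" "L < \<alpha>2"
        "\<forall>s\<in>{s0..<1}. quantile s (y s) \<le> cdf1 L"
        using guided_flow_limit[OF T x] unfolding s0_def by metis
      have "lo < L"
      \<comment> \<open>At ln w = 32^2 the claimed lower bound is zero; below that it is negative,
        and L > \<alpha>1 suffices.\<close>
      proof (cases "1024 < ln w")
        case True
        have "exp 1 \<le> (1024::real)" using exp_le by linarith
        then have "1 \<le> ln (ln w)" using True by (subst ln_ge_iff) auto
        \<comment> \<open>With ln (ln w) \<ge> 1 the quotient hypothesis bounds \<open>ln w\<close>
          itself, and \<open>min \<alpha>1 1 \<le> 1\<close> reduces it to 32 \<alpha>2 \<le> sqrt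
          (ln w).\<close>
        then have "ln w / ln (ln w) \<le> ln w / 1" using True by (intro divide_left_mono) auto
        then have a: "1024 * (\<alpha>2 / min \<alpha>1 1)\<^sup>2 \<le> ln w" using assms(10) by simp
        have "\<alpha>2 / 1 \<le> \<alpha>2 / min \<alpha>1 1" using assms(1,2) by (intro divide_left_mono) auto
        then have "\<alpha>2\<^sup>2 \<le> (\<alpha>2 / min \<alpha>1 1)\<^sup>2" using assms(1,2) by (intro power_mono) auto
        then have "(32 * \<alpha>2)\<^sup>2 \<le> ln w" using a by (simp add: power_mult_distrib)
        then have "32 * \<alpha>2 \<le> sqrt (ln w)" by (rule real_le_rsqrt)
        then show ?thesis unfolding lo_def
          by (intro flow_limit_lower[OF s0 y(1) True _ assms(9) _ L(2-4)]) (use x0 y in \<open>auto simp: r_def\<close>)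
      next
        case False
        then have "sqrt (ln w) \<le> sqrt (32\<^sup>2)" by (intro real_sqrt_le_mono) simp
        then have "sqrt (ln w) \<le> 32" by simp
        then have "1 \<le> 32 / sqrt (ln w)" using lw by simp
        then have "lo \<le> 0" unfolding lo_def using assms(1,2) by (simp add: mult_le_0_iff)
        then show ?thesis using L(2) assms(1) by linarith
      qed
      then show ?thesis using L by blast
    qed
    then show "x0 \<in> S" using ex unfolding S_def by blast
  qed
  have "measure std_normal_distribution {..<- r} \<le> exp (- (- r)\<^sup>2 / 2)"
  proof (rule std_normal_tail_le)
    fix u assume u: "u \<in> {..<- r}"
    have "0 \<le> r" using assms(1,3) w0 by (simp add: r_def)
    then have "0 \<le> r * (- r - u)" using u by (intro mult_nonneg_nonneg) auto
    then show "(- r)\<^sup>2 + (u - - r)\<^sup>2 \<le> u\<^sup>2" by (simp add: power2_eq_square algebra_simps)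
  qed simp
  moreover have "(- r)\<^sup>2 / 2 = w * \<alpha>1\<^sup>2 / (512 * \<beta>\<^sup>2)"
    unfolding r_def using w0 by (simp add: power_mult_distrib power_divide)
  moreover have "measure std_normal_distribution {- r..} = 1 - measure std_normal_distribution {..<- r}"
  proof -
    have "{- r..} = space std_normal_distribution - {..<- r}" by auto
    then show ?thesis using std_normal.prob_compl[of "{..<- r}"] by simp
  qed
  moreover have "measure std_normal_distribution {- r..} \<le> measure std_normal_distribution S"
    by (rule std_normal.finite_measure_mono[OF sub]) (use Sm in simp)
  ultimately have "1 - exp (- (w * \<alpha>1\<^sup>2 / (512 * \<beta>\<^sup>2))) \<le> measure std_normal_distribution S"
    by (simp only: minus_divide_left[symmetric])
  then show ?thesis unfolding S_def lo_def .
qed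

end
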